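(* Let $r\ge 2$ and regard the universal Coxeter group $\mathrm{UC}(r+1)$ as a subgroup of $\mathrm{O}(L,B)$ via its (integral) geometric representation. For $g\in\mathrm{UC}(r+1)$ let $\Phi_g(x)$ be the characteristic polynomial of $g$ regarded as a linear transformation of $L$. Then: (1) If $r$ is odd, there are infinitely many $g\in\mathrm{UC}(r+1)$ such that $\Phi_g(x)$ is a generalized Salem polynomial of degree $r+1$. If $r$ is even, there are infinitely many $g\in\mathrm{UC}(r+1)$ such that $\Phi_g(x)$ is the product of a generalized Salem polynomial of degree $r$ and $x+1$. (2) The characteristic polynomial $\Phi_w(x)$ of the Coxeter element $w=s_1s_2\cdots s_{r+1}$ of $\mathrm{UC}(r+1)$ is a Salem polynomial of degree $r+1$ if $r$ is odd, and is the product of a Salem polynomial of degree $r$ and $x+1$ if $r$ is even.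
   Context: Universal Coxeter group: $\mathrm{UC}(r+1)=\langle s_1\rangle*\langle s_2\rangle*\cdots*\langle s_{r+1}\rangle$, the free product of $r+1$ copies of $\mathbb{Z}/2$ with generators $s_1,\dots,s_{r+1}$ of order two. Geometric representation: let $L=\bigoplus_{j=1}^{r+1}\mathbb{Z}e_j$ with the symmetric bilinear form $B:L\times L\to\mathbb{Z}$ given by $B(e_i,e_i)=-1$ and $B(e_i,e_j)=1$ for $i\ne j$; $\mathrm{O}(L,B)$ is its integral orthogonal group. The homomorphism $\rho:\mathrm{UC}(r+1)\to\mathrm{O}(L,B)$ is defined by $\rho(s_i)(x)=x+2B(x,e_i)e_i$ for $x\in L$ and is known to be injective. For $r\ge2$ the form $B$ has signature $(1,r)$. Salem numbers and polynomials: a real algebraic integer $a$ is a Salem number if $a>1$ and its Galois conjugates are $a$, $1/a$ and some (possibly no) complex numbers of absolute value $1$. Its monic minimal polynomial in $\mathbb{Z}[x]$ is called a Salem polynomial. A monic polynomial in $\mathbb{Z}[x]$ is a generalized Salem polynomial if it is the minimal polynomial of $a$ or of $-a$ for some Salem number $a$. *)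

theory Defs
  imports "Jordan_Normal_Form.Char_Poly" "HOL-Algebra.Group"
begin

section \<open>The universal Coxeter group\<close>

text \<open>
  The free product of \<open>n\<close> copies of \<open>\<int>/2\<close>, in its normal form model: the generators are indexed by
  \<open>0, \<dots>, n - 1\<close> (so that index \<open>i\<close> stands for \<open>s\<^sub>i\<^sub>+\<^sub>1\<close>), elements are the words without two equal
  adjacent letters, and the product of two words is their concatenation followed by the
  cancellation of all subwords \<open>i i\<close>.
\<close>

definition uc_cons :: "nat \<Rightarrow> nat list \<Rightarrow> nat list" where
  "uc_cons i w = (if w \<noteq> [] \<and> hd w = i then tl w else i # w)"

definition UC :: "nat \<Rightarrow> nat list monoid" where
  "UC n = \<lparr>carrier = {w. set w \<subseteq> {..<n} \<and> distinct_adj w},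
           monoid.mult = (\<lambda>u v. foldr uc_cons u v),
           one = []\<rparr>"

definition uc_gen :: "nat \<Rightarrow> nat list" where
  "uc_gen i = [i]"

definition coxeter_element :: "nat \<Rightarrow> nat list" where
  "coxeter_element n = foldr (\<lambda>i w. uc_gen i \<otimes>\<^bsub>UC n\<^esub> w) [0..<n] \<one>\<^bsub>UC n\<^esub>"


section \<open>The geometric representation\<close>

text \<open>\<open>L\<close> is \<^term>\<open>carrier_vec n :: int vec set\<close>, with basis \<^term>\<open>unit_vec n i\<close>; endomorphisms of
  \<open>L\<close> are given by their matrices with respect to this basis.\<close>

definition gramB :: "nat \<Rightarrow> int mat" where
  "gramB n = mat n n (\<lambda>(i, j). if i = j then -1 else 1)"

definition formB :: "nat \<Rightarrow> int vec \<Rightarrow> int vec \<Rightarrow> int" where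
  "formB n x y = x \<bullet> (gramB n *\<^sub>v y)"

definition OLB :: "nat \<Rightarrow> int mat monoid" where
  "OLB n = \<lparr>carrier = {A \<in> carrier_mat n n. invertible_mat A \<and>
              (\<forall>x\<in>carrier_vec n. \<forall>y\<in>carrier_vec n. formB n (A *\<^sub>v x) (A *\<^sub>v y) = formB n x y)},
            monoid.mult = (*),
            one = 1\<^sub>m n\<rparr>"

definition reflection :: "nat \<Rightarrow> nat \<Rightarrow> int vec \<Rightarrow> int vec" where
  "reflection n i x = x + (2 * formB n x (unit_vec n i)) \<cdot>\<^sub>v unit_vec n i"

definition refl_mat :: "nat \<Rightarrow> nat \<Rightarrow> int mat" where
  "refl_mat n i = mat n n (\<lambda>(j, k). reflection n i (unit_vec n k) $ j)"

definition geom_rep :: "nat \<Rightarrow> nat list \<Rightarrow> int mat" where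
  "geom_rep n w = foldr (\<lambda>i A. refl_mat n i * A) w (1\<^sub>m n)"


section \<open>Salem numbers and Salem polynomials\<close>

definition is_min_poly :: "rat poly \<Rightarrow> complex \<Rightarrow> bool" where
  "is_min_poly p a \<longleftrightarrow> lead_coeff p = 1 \<and> poly (map_poly of_rat p) a = 0 \<and>
     (\<forall>q. q \<noteq> 0 \<and> poly (map_poly of_rat q) a = 0 \<longrightarrow> degree p \<le> degree q)"

definition is_int_min_poly :: "int poly \<Rightarrow> complex \<Rightarrow> bool" where
  "is_int_min_poly p a \<longleftrightarrow> is_min_poly (map_poly of_int p) a"

definition galois_conjugates :: "complex \<Rightarrow> complex set" where
  "galois_conjugates a = {b. \<exists>p. is_min_poly p a \<and> poly (map_poly of_rat p) b = 0}"

definition salem_number :: "real \<Rightarrow> bool" where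
  "salem_number a \<longleftrightarrow> algebraic_int a \<and> a > 1 \<and>
     (\<exists>S. (\<forall>z\<in>S. cmod z = 1) \<and>
          galois_conjugates (complex_of_real a) = {complex_of_real a, complex_of_real (1 / a)} \<union> S)"

definition salem_poly :: "int poly \<Rightarrow> bool" where
  "salem_poly p \<longleftrightarrow> (\<exists>a. salem_number a \<and> is_int_min_poly p (complex_of_real a))"

definition generalized_salem_poly :: "int poly \<Rightarrow> bool" where
  "generalized_salem_poly p \<longleftrightarrow> (\<exists>a. salem_number a \<and>
     (is_int_min_poly p (complex_of_real a) \<or> is_int_min_poly p (complex_of_real (- a))))"


section \<open>The representation is a homomorphism of groups into \<open>O(L, B)\<close>\<close>

lemma uc_cons_closed:
  assumes "distinct_adj w" "set w \<subseteq> {..<n}" "i < n"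
  shows "distinct_adj (uc_cons i w)" "set (uc_cons i w) \<subseteq> {..<n}"
  using assms by (cases w; auto simp: uc_cons_def distinct_adj_Cons)+

lemma uc_cons_uc_cons:
  assumes "distinct_adj w"
  shows "uc_cons i (uc_cons i w) = w"
  using assms by (cases w; cases "tl w"; auto simp: uc_cons_def distinct_adj_Cons)

lemma foldr_uc_cons_closed:
  assumes "distinct_adj w" "set w \<subseteq> {..<n}" "set u \<subseteq> {..<n}"
  shows "distinct_adj (foldr uc_cons u w) \<and> set (foldr uc_cons u w) \<subseteq> {..<n}"
  using assms(3) by (induction u) (use assms(1,2) uc_cons_closed in auto)

lemma foldr_uc_cons_uc_cons:
  assumes "distinct_adj v" "set v \<subseteq> {..<n}" "set w \<subseteq> {..<n}"
  shows "foldr uc_cons (uc_cons i w) v = uc_cons i (foldr uc_cons w v)"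
proof (cases "w \<noteq> [] \<and> hd w = i")
  case True
  then obtain u where u: "w = i # u" by (cases w) auto
  have "distinct_adj (foldr uc_cons u v)"
    using foldr_uc_cons_closed[of v n u] assms u by auto
  then show ?thesis using u by (simp add: uc_cons_def[of i "i # u"] uc_cons_uc_cons)
qed (auto simp: uc_cons_def)

lemma foldr_uc_cons_assoc:
  assumes "distinct_adj v" "distinct_adj w" "set u \<subseteq> {..<n}" "set v \<subseteq> {..<n}" "set w \<subseteq> {..<n}"
  shows "foldr uc_cons (foldr uc_cons u v) w = foldr uc_cons u (foldr uc_cons v w)"
  using assms(3)
proof (induction u)
  case (Cons i u)
  have "set (foldr uc_cons u v) \<subseteq> {..<n}"
    using foldr_uc_cons_closed[of v n u] assms Cons.prems by auto
  then show ?case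
    using Cons foldr_uc_cons_uc_cons[of w n "foldr uc_cons u v" i] assms by simp
qed simp

lemma foldr_uc_cons_reduced:
  assumes "distinct_adj w"
  shows "foldr uc_cons w [] = w"
  using assms by (induction w) (auto simp: uc_cons_def distinct_adj_Cons)

lemma foldr_uc_cons_rev: "foldr uc_cons (rev w) w = []"
proof -
  have "foldr uc_cons (rev w) (w @ v) = v" for v
    by (induction w) (auto simp: uc_cons_def)
  from this[of "[]"] show ?thesis by simp
qed

lemma group_UC: "group (UC n)"
proof (rule groupI)
  fix x assume "x \<in> carrier (UC n)"
  then show "\<exists>y\<in>carrier (UC n). y \<otimes>\<^bsub>UC n\<^esub> x = \<one>\<^bsub>UC n\<^esub>"
    by (intro bexI[of _ "rev x"]) (auto simp: UC_def foldr_uc_cons_rev)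
qed (use foldr_uc_cons_closed in \<open>auto simp: UC_def foldr_uc_cons_assoc\<close>)

lemma uc_gen_squared: "uc_gen i \<otimes>\<^bsub>UC n\<^esub> uc_gen i = \<one>\<^bsub>UC n\<^esub>"
  by (simp add: UC_def uc_gen_def uc_cons_def)

lemma coxeter_element_eq: "coxeter_element n = [0..<n]"
proof -
  have "distinct xs \<Longrightarrow> foldr (\<lambda>i w. uc_gen i \<otimes>\<^bsub>UC n\<^esub> w) xs \<one>\<^bsub>UC n\<^esub> = xs" for xs
    by (induction xs) (auto simp: UC_def uc_gen_def uc_cons_def)
  then show ?thesis by (simp add: coxeter_element_def)
qed

lemma gramB_carrier [simp]: "gramB n \<in> carrier_mat n n"
  by (simp add: gramB_def)

lemma gramB_mult_carrier [simp]: "gramB n *\<^sub>v x \<in> carrier_vec n"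
  by (rule carrier_vecI) (simp add: gramB_def)

lemma formB_unit_vec:
  assumes "i < n" "j < n"
  shows "formB n (unit_vec n i) (unit_vec n j) = (if i = j then -1 else 1)"
  using assms by (simp add: formB_def) (simp add: gramB_def)

lemma refl_mat_carrier [simp]: "refl_mat n i \<in> carrier_mat n n"
  by (simp add: refl_mat_def)

lemma formB_add_right:
  assumes "x \<in> carrier_vec n" "y \<in> carrier_vec n" "z \<in> carrier_vec n"
  shows "formB n x (y + z) = formB n x y + formB n x z"
  using assms by (simp add: formB_def mult_add_distrib_mat_vec[of _ n n]
    scalar_prod_add_distrib[of _ n])

lemma formB_smult_right:
  assumes "x \<in> carrier_vec n" "y \<in> carrier_vec n"
  shows "formB n x (c \<cdot>\<^sub>v y) = c * formB n x y"
proof -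
  have "gramB n *\<^sub>v (c \<cdot>\<^sub>v y) = c \<cdot>\<^sub>v (gramB n *\<^sub>v y)"
    using assms by (intro eq_vecI) (auto simp: gramB_def)
  then show ?thesis
    using assms by (simp add: formB_def scalar_prod_smult_distrib[of _ n])
qed

lemma formB_sym:
  assumes "x \<in> carrier_vec n" "y \<in> carrier_vec n"
  shows "formB n x y = formB n y x"
proof -
  have G: "gramB n \<in> carrier_mat n n" by (simp add: gramB_def)
  have "transpose_mat (gramB n) = gramB n" by (auto simp: gramB_def)
  then show ?thesis
    using assms G transpose_vec_mult_scalar[OF G assms(2,1)]
    by (metis comm_scalar_prod formB_def mult_mat_vec_carrier)
qed

lemma refl_mat_mult_vec:
  assumes "x \<in> carrier_vec n" "i < n"
  shows "refl_mat n i *\<^sub>v x = reflection n i x"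
proof (rule eq_vecI)
  fix j assume "j < dim_vec (reflection n i x)"
  then have j: "j < n" using assms by (simp add: reflection_def)
  have B: "formB n x (unit_vec n i) = (\<Sum>k<n. x $ k * (if k = i then -1 else 1))"
    if "x \<in> carrier_vec n" for x
  proof -
    have "(gramB n *\<^sub>v unit_vec n i) $ k = (if k = i then -1 else 1)" if "k < n" for k
      using that assms by (simp add: gramB_def)
    moreover have "dim_vec (gramB n *\<^sub>v unit_vec n i) = n"
      by (simp add: gramB_def)
    ultimately show ?thesis
      by (simp add: formB_def scalar_prod_def lessThan_atLeast0)
  qed
  have "(refl_mat n i *\<^sub>v x) $ j = (\<Sum>k<n. reflection n i (unit_vec n k) $ j * x $ k)"
    using assms j by (simp add: refl_mat_def scalar_prod_def lessThan_atLeast0)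
  also have "\<dots> = (\<Sum>k<n. (if j = k then x $ k else 0) +
      2 * (x $ k * (if k = i then -1 else 1)) * (if j = i then 1 else 0))"
    using assms j
    by (intro sum.cong) (auto simp: reflection_def formB_unit_vec)
  also have "\<dots> = x $ j + 2 * formB n x (unit_vec n i) * (if j = i then 1 else 0)"
    using j by (simp add: sum.distrib B[OF assms(1)] sum_distrib_left sum_distrib_right)
  also have "\<dots> = reflection n i x $ j"
    using assms j by (simp add: reflection_def)
  finally show "(refl_mat n i *\<^sub>v x) $ j = reflection n i x $ j" .
qed (use assms in \<open>simp add: reflection_def refl_mat_def\<close>)

lemma reflection_carrier [simp]: "x \<in> carrier_vec n \<Longrightarrow> reflection n i x \<in> carrier_vec n"
  by (simp add: reflection_def)

lemma formB_reflection:
  assumes "x \<in> carrier_vec n" "y \<in> carrier_vec n" "i < n"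
  shows "formB n (reflection n i x) (reflection n i y) = formB n x y"
proof -
  have r: "formB n z (reflection n i y) =
      formB n z y + 2 * formB n y (unit_vec n i) * formB n z (unit_vec n i)"
    if "z \<in> carrier_vec n" for z
    using that assms by (simp add: reflection_def formB_add_right formB_smult_right)
  have l: "formB n (reflection n i x) z =
      formB n x z + 2 * formB n x (unit_vec n i) * formB n (unit_vec n i) z"
    if "z \<in> carrier_vec n" for z
    using that assms
    by (subst (1 2 4) formB_sym) (auto simp: reflection_def formB_add_right formB_smult_right)
  show ?thesis
    using assms by (simp add: r l formB_unit_vec formB_sym[of "unit_vec n i" n y] algebra_simps)
qed

lemma refl_mat_squared:
  assumes "i < n"
  shows "refl_mat n i * refl_mat n i = 1\<^sub>m n"
proof (rule eq_matI)
  fix j k assume "j < dim_row (1\<^sub>m n :: int mat)" "k < dim_col (1\<^sub>m n :: int mat)"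
  then have jk: "j < n" "k < n" by auto
  let ?e = "unit_vec n k :: int vec"
  have l: "formB n (reflection n i ?e) (unit_vec n i) = - formB n ?e (unit_vec n i)"
    using assms jk
    by (subst formB_sym)
      (auto simp: reflection_def formB_add_right formB_smult_right formB_unit_vec)
  have c: "col (refl_mat n i) k = reflection n i ?e"
    using jk by (auto simp: refl_mat_def reflection_def)
  have "col (refl_mat n i * refl_mat n i) k = refl_mat n i *\<^sub>v col (refl_mat n i) k"
    using jk by (intro col_mult2[of _ n n _ n]) auto
  also have "\<dots> = reflection n i (reflection n i ?e)"
    using assms jk by (simp add: c refl_mat_mult_vec)
  also have "\<dots> = ?e"
    by (rule eq_vecI) (simp_all add: reflection_def[of n i "reflection n i ?e"] l,
      simp_all add: reflection_def)
  finally have "col (refl_mat n i * refl_mat n i) k = ?e" .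
  moreover have "(refl_mat n i * refl_mat n i) $$ (j, k) = col (refl_mat n i * refl_mat n i) k $ j"
    using jk by (simp add: refl_mat_def)
  ultimately show "(refl_mat n i * refl_mat n i) $$ (j, k) = 1\<^sub>m n $$ (j, k)"
    using jk by simp
qed (auto simp: refl_mat_def)

lemma geom_rep_carrier [simp]: "geom_rep n w \<in> carrier_mat n n"
  by (induction w) (auto simp: geom_rep_def intro!: mult_carrier_mat[of _ n n])

lemma geom_rep_uc_cons:
  assumes "set w \<subseteq> {..<n}" "i < n"
  shows "geom_rep n (uc_cons i w) = refl_mat n i * geom_rep n w"
proof (cases "w \<noteq> [] \<and> hd w = i")
  case True
  then obtain u where u: "w = i # u" by (cases w) auto
  have "refl_mat n i * (refl_mat n i * geom_rep n u) = geom_rep n u"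
    using assms left_mult_one_mat[OF geom_rep_carrier[of n u]]
    by (simp flip: assoc_mult_mat[of _ n n _ n _ n] add: refl_mat_squared)
  then show ?thesis using u by (simp add: uc_cons_def geom_rep_def)
qed (auto simp: uc_cons_def geom_rep_def)

lemma geom_rep_mult:
  assumes "set u \<subseteq> {..<n}" "set v \<subseteq> {..<n}" "distinct_adj v"
  shows "geom_rep n (foldr uc_cons u v) = geom_rep n u * geom_rep n v"
  using assms(1)
proof (induction u)
  case Nil
  then show ?case
    using left_mult_one_mat[OF geom_rep_carrier[of n v]] by (simp add: geom_rep_def[of n "[]"])
next
  case (Cons i u)
  have "set (foldr uc_cons u v) \<subseteq> {..<n}"
    using foldr_uc_cons_closed[of v n u] assms Cons.prems by auto
  then have "geom_rep n (foldr uc_cons (i # u) v) = refl_mat n i * (geom_rep n u * geom_rep n v)"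
    using Cons by (simp add: geom_rep_uc_cons)
  also have "\<dots> = geom_rep n (i # u) * geom_rep n v"
    by (simp add: geom_rep_def[of n "i # u"] assoc_mult_mat[of _ n n _ n _ n]
      flip: geom_rep_def)
  finally show ?case .
qed

lemma geom_rep_formB:
  assumes "set w \<subseteq> {..<n}" "x \<in> carrier_vec n" "y \<in> carrier_vec n"
  shows "formB n (geom_rep n w *\<^sub>v x) (geom_rep n w *\<^sub>v y) = formB n x y"
  using assms(1)
proof (induction w)
  case Nil
  then show ?case using assms by (simp add: geom_rep_def)
next
  case (Cons i w)
  have "geom_rep n (i # w) *\<^sub>v z = reflection n i (geom_rep n w *\<^sub>v z)"
    if "z \<in> carrier_vec n" for z
    using Cons.prems that
    by (simp add: geom_rep_def[of n "i # w"] assoc_mult_mat_vec[of _ n n _ n] refl_mat_mult_vec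
      mult_mat_vec_carrier[of _ n n] flip: geom_rep_def)
  then show ?case
    using Cons assms by (simp add: formB_reflection mult_mat_vec_carrier[of _ n n])
qed

lemma geom_rep_hom: "geom_rep n \<in> hom (UC n) (OLB n)"
proof (rule homI)
  fix u assume u: "u \<in> carrier (UC n)"
  then have v: "rev u \<in> carrier (UC n)" by (simp add: UC_def)
  have "geom_rep n (rev u) * geom_rep n u = 1\<^sub>m n" "geom_rep n u * geom_rep n (rev u) = 1\<^sub>m n"
    using u v geom_rep_mult[of "rev u" n u] geom_rep_mult[of u n "rev u"]
      foldr_uc_cons_rev[of u] foldr_uc_cons_rev[of "rev u"]
    by (simp_all add: UC_def geom_rep_def[of n "[]"])
  moreover have "dim_row (geom_rep n w) = n" "dim_col (geom_rep n w) = n" for w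
    using geom_rep_carrier[of n w] by (blast dest: carrier_matD)+
  ultimately have "invertible_mat (geom_rep n u)"
    unfolding invertible_mat_def inverts_mat_def
    by (auto simp: square_mat.simps intro!: exI[of _ "geom_rep n (rev u)"])
  then show "geom_rep n u \<in> carrier (OLB n)"
    using u geom_rep_formB by (auto simp: UC_def OLB_def)
next
  fix u v assume "u \<in> carrier (UC n)" "v \<in> carrier (UC n)"
  then show "geom_rep n (u \<otimes>\<^bsub>UC n\<^esub> v) = geom_rep n u \<otimes>\<^bsub>OLB n\<^esub> geom_rep n v"
    using geom_rep_mult by (auto simp: UC_def OLB_def)
qed

end

theory Submission
  imports Defs "Berlekamp_Zassenhaus.Factor_Bound"
begin

text \<open>
  Write \<open>n = r + 1\<close> and let \<open>A\<close> be the matrix of the Coxeter element. Each solution \<open>w \<noteq> 1\<close> of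
  \<open>w\<^sup>n (3 - w) = 3 w - 1\<close> gives an eigenvector \<open>(1, w, w\<^sup>2, \<dots>)\<close> of \<open>A\<close> with eigenvalue
  \<open>s = (3 - w) / (3 w - 1) = w\<^sup>-\<^sup>n\<close>. On the unit circle the equation becomes
  \<open>sin ((n + 1) t / 2) = 3 sin ((n - 1) t / 2)\<close>, which has \<open>n - 2\<close> solutions by the intermediate
  value theorem; with a real pair \<open>u, 1/u\<close> this yields \<open>n\<close> distinct eigenvalues: \<open>a > 1\<close>, \<open>1/a\<close> and
  \<open>n - 2\<close> numbers of modulus one.

  All eigenvalues satisfy \<open>s (s + 3)\<^sup>n = (3 s + 1)\<^sup>n\<close>. Reducing modulo 3 in a cyclotomic ring shows
  that the only roots of unity among them can be \<open>\<plusminus>1\<close>. Hence, after removing the factor \<open>x + 1\<close> for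
  odd \<open>n\<close>, a proper factor not vanishing at \<open>a\<close> would contradict Kronecker's theorem, so the rest is
  the minimal polynomial of \<open>a\<close>. The infinite family consists of powers \<open>A\<^sup>k\<close> whose eigenvalues \<open>s\<^sup>k\<close>
  are again pairwise distinct.
\<close>

hide_const (open) up_ring.monom up_ring.coeff module.smult

section \<open>Kronecker's theorem\<close>

text \<open>Pseudo-division scales by a power of the leading coefficient of \<open>h\<close>, which
  is 1, so it is a true division over the integers.\<close>

lemma monic_int_poly_reduce:
  fixes h p :: "int poly"
  assumes "lead_coeff h = 1"
  obtains r where "h dvd p - r" "r = 0 \<or> degree r < degree h"
proof -
  from assms have h0: "h \<noteq> 0" by auto
  obtain q r where qr: "pseudo_divmod p h = (q, r)" by fastforce
  from pseudo_divmod[OF h0 qr] assms have "p = h * q + r" "r = 0 \<or> degree r < degree h" by auto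
  then show ?thesis using that[of r] by simp
qed

lemma degree_prod_linear: "finite T \<Longrightarrow> degree (\<Prod>s\<in>T. [:- s, 1::'a::idom:]) = card T"
  by (subst degree_prod_eq_sum_degree) auto

lemma lead_coeff_prod_linear: "lead_coeff (\<Prod>s\<in>T. [:- s, 1::'a::idom:]) = 1"
  by (simp add: lead_coeff_prod)

lemma poly_prod_linear_eq_0_iff:
  "finite T \<Longrightarrow> poly (\<Prod>s\<in>T. [:- s, 1::'a::idom:]) z = 0 \<longleftrightarrow> z \<in> T"
  by (auto simp: poly_prod)

lemma poly_of_int_poly_simps:
  fixes z :: "'a :: field_char_0"
  shows "poly (of_int_poly (p + q)) z = poly (of_int_poly p) z + poly (of_int_poly q) z"
    and "poly (of_int_poly (p - q)) z = poly (of_int_poly p) z - poly (of_int_poly q) z"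
    and "poly (of_int_poly (p * q)) z = poly (of_int_poly p) z * poly (of_int_poly q) z"
    and "poly (of_int_poly (smult c p)) z = of_int c * poly (of_int_poly p) z"
    and "poly (of_int_poly (monom c k)) z = of_int c * z ^ k"
    and "poly (monom 1 k) z = z ^ k"
    and "poly (of_int_poly (\<Sum>i\<in>I. f i)) z = (\<Sum>i\<in>I. poly (of_int_poly (f i)) z)"
  by (simp_all add: hom_distribs poly_monom poly_sum)

lemma poly_of_int_poly_dvd:
  fixes s :: "'a :: field_char_0"
  assumes "h dvd p - r" "poly (of_int_poly h) s = 0"
  shows "poly (of_int_poly p) s = poly (of_int_poly r) s"
proof -
  obtain q where "p - r = h * q" using assms(1) by blast
  then have "p = h * q + r" by (simp add: algebra_simps)
  then show ?thesis using assms(2) by (simp add: poly_of_int_poly_simps)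
qed

text \<open>By Lagrange interpolation at \<open>T\<close>, the values on \<open>T\<close> determine
  all coefficients and bound them by \<open>M\<close>. Integrality leaves only finitely many
  coefficient lists.\<close>

lemma finite_int_polys_bounded_on:
  fixes T :: "complex set"
  assumes fin: "finite T"
  shows "finite {p :: int poly. degree p < card T \<and> (\<forall>s\<in>T. cmod (poly (of_int_poly p) s) \<le> 1)}"
    (is "finite ?A")
proof -
  \<comment> \<open>\<open>L s\<close> is the Lagrange basis polynomial: 1 at \<open>s\<close>, 0 at
    the other points of \<open>T\<close>.\<close>
  define L where "L s = (\<Prod>t\<in>T - {s}. smult (inverse (s - t)) [:- t, 1:])" for s
  define M where "M = (\<Sum>s\<in>T. \<Sum>i<card T. cmod (coeff (L s) i))"
  have degL: "degree (L s) < card T" if "s \<in> T" for s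
  proof -
    have "degree (L s) \<le> (\<Sum>t\<in>T - {s}. degree (smult (inverse (s - t)) [:- t, 1:]))"
      unfolding L_def by (rule degree_prod_sum_le[unfolded o_def]) (use fin in auto)
    also have "\<dots> \<le> (\<Sum>t\<in>T - {s}. 1)" by (intro sum_mono) auto
    also have "\<dots> < card T"
      using fin that card_gt_0_iff[of T] by auto
    finally show ?thesis .
  qed
  have Ls: "poly (L s) t = (if s = t then 1 else 0)" if "s \<in> T" "t \<in> T" for s t
  proof -
    have "poly (L s) t = (\<Prod>x\<in>T - {s}. inverse (s - x) * (t - x))"
      by (simp add: L_def poly_prod algebra_simps)
    moreover have "\<dots> = 0" if "s \<noteq> t"
      using that \<open>t \<in> T\<close> fin by (intro prod_zero) auto
    moreover have "(\<Prod>x\<in>T - {s}. inverse (s - x) * (s - x)) = 1"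
      by (intro prod.neutral ballI left_inverse) auto
    ultimately show ?thesis by auto
  qed
  have interp: "of_int_poly p = (\<Sum>s\<in>T. smult (poly (of_int_poly p) s) (L s))"
    if "p \<in> ?A" for p
  proof (rule poly_eqI_degree[of T])
    fix t assume t: "t \<in> T"
    have "(\<Sum>s\<in>T. poly (of_int_poly p) s * poly (L s) t) =
        (\<Sum>s\<in>T. if s = t then poly (of_int_poly p) s else 0)"
      by (intro sum.cong) (auto simp: Ls t)
    then show "poly (of_int_poly p) t = poly (\<Sum>s\<in>T. smult (poly (of_int_poly p) s) (L s)) t"
      using t fin by (simp add: poly_sum)
  next
    show "degree (\<Sum>s\<in>T. smult (poly (of_int_poly p) s) (L s)) < card T"
    proof (rule degree_sum_less)
      show "degree (smult (poly (of_int_poly p) s) (L s)) < card T" if "s \<in> T" for s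
        using degL[OF that] by (meson degree_smult_le le_less_trans)
    qed (use that in auto)
  qed (use that in auto)
  have bnd: "\<bar>coeff p i\<bar> \<le> \<lceil>M\<rceil>" if p: "p \<in> ?A" and i: "i < card T" for p i
  proof -
    have "of_int (coeff p i) = coeff (of_int_poly p :: complex poly) i" by simp
    also have "\<dots> = (\<Sum>s\<in>T. poly (of_int_poly p) s * coeff (L s) i)"
      by (subst interp[OF p]) (simp add: coeff_sum)
    finally have "cmod (of_int (coeff p i)) \<le> (\<Sum>s\<in>T. cmod (poly (of_int_poly p) s * coeff (L s) i))"
      by (simp add: norm_sum)
    also have "\<dots> \<le> (\<Sum>s\<in>T. cmod (coeff (L s) i))"
      using p by (intro sum_mono) (auto simp: norm_mult mult_left_le_one_le)
    also have "\<dots> \<le> M"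
      unfolding M_def using i
      by (intro sum_mono member_le_sum[of i "{..<card T}" "\<lambda>i. cmod (coeff (L _) i)"]) auto
    finally show ?thesis by (simp add: le_ceiling_iff)
  qed
  let ?X = "{xs. set xs \<subseteq> {- \<lceil>M\<rceil>..\<lceil>M\<rceil>} \<and> length xs = card T}"
  have "?A \<subseteq> Poly ` ?X"
  proof
    fix p assume p: "p \<in> ?A"
    have "p = Poly (map (coeff p) [0..<card T])"
      using p by (intro poly_eqI) (auto simp: nth_default_def coeff_eq_0)
    moreover have "map (coeff p) [0..<card T] \<in> ?X"
      using bnd[OF p] by (fastforce simp: abs_le_iff)
    ultimately show "p \<in> Poly ` ?X" by blast
  qed
  then show ?thesis
    by (rule finite_subset) (intro finite_imageI finite_lists_length_eq, simp)
qed

text \<open>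
  The remainders of \<open>x\<^sup>k\<close> modulo \<open>h\<close> take the values \<open>s\<^sup>k\<close> on \<open>T\<close>, so two of them coincide.
\<close>

lemma kronecker_root_of_unity:
  fixes h :: "int poly" and T :: "complex set"
  assumes h: "of_int_poly h = (\<Prod>s\<in>T. [:- s, 1:])" and fin: "finite T"
    and le: "\<And>s. s \<in> T \<Longrightarrow> cmod s \<le> 1" and s: "s \<in> T" "s \<noteq> 0"
  shows "\<exists>m>0. s ^ m = 1"
proof -
  have "degree (of_int_poly h :: complex poly) = card T" "lead_coeff (of_int_poly h :: complex poly) = 1"
    unfolding h by (rule degree_prod_linear[OF fin], rule lead_coeff_prod_linear)
  then have deg: "degree h = card T" and lc: "lead_coeff h = 1" by auto
  have cT: "card T > 0" using s(1) fin by (auto simp: card_gt_0_iff)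
  have root: "poly (of_int_poly h) t = 0" if "t \<in> T" for t
    using that fin by (auto simp: h poly_prod)
  have "\<exists>r. h dvd monom 1 k - r \<and> degree r < card T" for k
    using monic_int_poly_reduce[OF lc, of "monom 1 k"] deg cT by (metis degree_0)
  then obtain r where r: "\<And>k. h dvd monom 1 k - r k" "\<And>k. degree (r k) < card T" by metis
  have val: "poly (of_int_poly (r k)) t = t ^ k" if "t \<in> T" for t k
    using poly_of_int_poly_dvd[OF r(1) root[OF that]] by (simp add: poly_monom)
  have "range r \<subseteq> {p. degree p < card T \<and> (\<forall>s\<in>T. cmod (poly (of_int_poly p) s) \<le> 1)}"
    using r(2) le by (auto simp: val norm_power power_le_one)
  then have "finite (range r)" by (rule finite_subset) (rule finite_int_polys_bounded_on[OF fin])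
  then have "\<not> inj r" using finite_imageD infinite_UNIV_nat by blast
  then obtain i j where ij: "i < j" "r i = r j" by (metis injI linorder_neqE_nat)
  then have "s ^ i = s ^ j" using val[OF s(1)] by metis
  also have "\<dots> = s ^ i * s ^ (j - i)" using ij by (simp flip: power_add)
  finally have "s ^ (j - i) = 1" using s(2) by simp
  with ij show ?thesis by (intro exI[of _ "j - i"]) auto
qed

section \<open>Algebraic integrality from integer matrices\<close>

lemma algebraic_int_of_eigenvalue:
  fixes A :: "int mat" and z :: "'a :: field_char_0"
  assumes A: "A \<in> carrier_mat n n" and ev: "eigenvalue (map_mat of_int A) z"
  shows "algebraic_int z"
proof -
  have "poly (char_poly (map_mat of_int A)) z = 0"
    using ev eigenvalue_root_char_poly[of "map_mat of_int A" n z] A by auto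
  then have "poly (of_int_poly (char_poly A)) z = 0"
    by (simp add: of_int_hom.char_poly_hom[OF A])
  moreover have "lead_coeff (char_poly A) = 1"
    using degree_monic_char_poly[OF A] by auto
  ultimately show ?thesis unfolding algebraic_int_altdef_ipoly by blast
qed

text \<open>
  Multiplication by \<open>p(z)\<close> acts on the powers \<open>1, z, \<dots>, z\<^sup>d\<^sup>-\<^sup>1\<close> by an integer matrix.
\<close>

lemma algebraic_int_poly_of_root:
  fixes z :: "'a :: field_char_0" and h p :: "int poly"
  assumes lc: "lead_coeff h = 1" and z: "poly (of_int_poly h) z = 0"
  shows "algebraic_int (poly (of_int_poly p) z)"
proof -
  define d where "d = degree h"
  have d0: "d > 0"
  proof (rule ccontr)
    assume "\<not> d > 0"
    then have "degree h = 0" by (simp add: d_def)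
    then obtain c where c: "h = [:c:]" by (rule degree_eq_zeroE)
    with lc have "c = 1" by simp
    then show False using z c by simp
  qed
  have "\<exists>r. h dvd p * monom 1 i - r \<and> degree r < d" for i
    using monic_int_poly_reduce[OF lc, of "p * monom 1 i"] d0 unfolding d_def by (metis degree_0)
  then obtain r where r: "\<And>i. h dvd p * monom 1 i - r i" "\<And>i. degree (r i) < d" by metis
  \<comment> \<open>Row \<open>i\<close> holds the coefficients of the remainder of
    \<open>p * x^i\<close> modulo \<open>h\<close>, whose value at \<open>z\<close> is
    \<open>p(z) * z^i\<close>.\<close>
  define A where "A = mat d d (\<lambda>(i, j). coeff (r i) j)"
  define v where "v = vec d (\<lambda>i. z ^ i)"
  have "(map_mat of_int A *\<^sub>v v) $ i = (poly (of_int_poly p) z \<cdot>\<^sub>v v) $ i" if i: "i < d" for i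
  proof -
    have "(map_mat of_int A *\<^sub>v v) $ i = (\<Sum>j<d. of_int (coeff (r i) j) * z ^ j)"
      using i by (simp add: A_def v_def scalar_prod_def lessThan_atLeast0)
    also have "\<dots> = (\<Sum>j\<le>degree (r i). of_int (coeff (r i) j) * z ^ j)"
      using r(2)[of i] by (intro sum.mono_neutral_right) (auto simp: coeff_eq_0)
    also have "\<dots> = poly (of_int_poly (r i)) z"
      by (simp add: poly_altdef)
    also have "\<dots> = poly (of_int_poly p) z * z ^ i"
      using poly_of_int_poly_dvd[OF r(1) z, of i] by (simp add: poly_of_int_poly_simps)
    finally show ?thesis using i by (simp add: v_def)
  qed
  then have "map_mat of_int A *\<^sub>v v = poly (of_int_poly p) z \<cdot>\<^sub>v v"
    by (intro eq_vecI) (auto simp: A_def v_def)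
  moreover have "v \<noteq> 0\<^sub>v d"
  proof
    assume "v = 0\<^sub>v d"
    then have "v $ 0 = 0" using d0 by simp
    then show False using d0 by (simp add: v_def)
  qed
  ultimately have "eigenvalue (map_mat of_int A) (poly (of_int_poly p) z)"
    unfolding eigenvalue_def eigenvector_def by (intro exI[of _ v]) (auto simp: A_def v_def)
  then show ?thesis
    by (intro algebraic_int_of_eigenvalue[of A d]) (auto simp: A_def)
qed

section \<open>Roots of unity congruent to one modulo three\<close>

text \<open>
  A power \<open>x \<equiv> 1\<close> of prime order \<open>l\<close> satisfies \<open>0 = 1 + x + \<dots> + x\<^sup>l\<^sup>-\<^sup>1 \<equiv> l\<close>, which forces \<open>l = 3\<close>; but then
  \<open>1 + x + x\<^sup>2 \<equiv> 3\<close> modulo 9.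
\<close>

lemma root_of_unity_cong_1_mod_3:
  fixes z w :: complex and p :: "int poly"
  assumes z: "z ^ m = 1" "m > 0" and w: "w ^ k = 1" "k > 0"
    and cong: "w = 1 + 3 * poly (of_int_poly p) z"
  shows "w = 1"
proof (rule ccontr)
  assume w1: "w \<noteq> 1"
  let ?e = "\<lambda>p. poly (of_int_poly p) z"
  have int: "algebraic_int (?e q)" for q
  proof (rule algebraic_int_poly_of_root)
    show "lead_coeff (monom 1 m - 1 :: int poly) = 1"
    proof -
      have "degree (monom 1 m - 1 :: int poly) = degree (monom 1 m :: int poly)"
        using degree_add_eq_left[of "- 1 :: int poly" "monom 1 m"] z(2)
        by (simp add: degree_monom_eq)
      then show ?thesis using z(2) by (simp add: degree_monom_eq)
    qed
    show "poly (of_int_poly (monom 1 m - 1)) z = 0"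
      using z(1) by (simp add: poly_of_int_poly_simps)
  qed
  \<comment> \<open>A rational algebraic integer is an integer, so an integer divisible by 3 in Z[z]
    is already divisible by 3 in Z.\<close>
  have no_third: "3 dvd i" if "3 * ?e q = of_int i" for q i
  proof -
    have q: "?e q = of_rat (of_int i / 3)"
      using that by (simp add: of_rat_divide field_simps)
    then have "?e q \<in> \<int>" using int rational_algebraic_int_is_int by (metis Rats_of_rat)
    then obtain j where "?e q = of_int j" by (auto elim: Ints_cases)
    with that have "of_int (3 * j) = (of_int i :: complex)" by simp
    then show ?thesis by (metis dvd_triv_left of_int_eq_iff)
  qed
  \<comment> \<open>\<open>d\<close> is the exact order of \<open>w\<close>, so that the power
    \<open>x\<close> below has prime order \<open>l\<close>.\<close>
  define d where "d = (LEAST k. k > 0 \<and> w ^ k = 1)"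
  have d: "d > 0" "w ^ d = 1" and d_min: "\<And>j. j > 0 \<Longrightarrow> w ^ j = 1 \<Longrightarrow> d \<le> j"
    using LeastI[of "\<lambda>k. k > 0 \<and> w ^ k = 1" k] w Least_le[of "\<lambda>k. k > 0 \<and> w ^ k = 1"]
    by (auto simp: d_def)
  have "d \<noteq> 1" using d w1 by auto
  then obtain l where l: "prime l" "l dvd d" using prime_factor_nat by blast
  define x where "x = w ^ (d div l)"
  have l0: "l > 1" using l(1) prime_gt_1_nat by blast
  have xl: "x ^ l = 1" using d l by (simp add: x_def flip: power_mult)
  have x1: "x \<noteq> 1"
  proof
    assume "x = 1"
    moreover have "d div l > 0" using l d by (auto elim!: dvdE)
    ultimately have "d \<le> d div l" using d_min by (simp add: x_def)
    moreover have "d div l < d" using l0 d by simp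
    ultimately show False by simp
  qed
  \<comment> \<open>The set 1 + 3 Z[z] is closed under multiplication, so it contains all powers of
    \<open>w\<close> and hence of \<open>x\<close>.\<close>
  have pow: "\<exists>q. w ^ j = 1 + 3 * ?e q" for j
  proof (induction j)
    case 0
    show ?case by (intro exI[of _ 0]) simp
  next
    case (Suc j)
    then obtain q where "w ^ j = 1 + 3 * ?e q" by blast
    then have "w ^ Suc j = (1 + 3 * ?e p) * (1 + 3 * ?e q)" using cong by simp
    also have "\<dots> = 1 + 3 * ?e (q + p + smult 3 (p * q))"
      by (simp add: poly_of_int_poly_simps ring_distribs)
    finally show ?case by blast
  qed
  then have "\<exists>q. x ^ j = 1 + 3 * ?e q" for j
    by (simp add: x_def flip: power_mult)
  then obtain Q where Q: "\<And>j. x ^ j = 1 + 3 * ?e (Q j)" by metis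
  have sum0: "(\<Sum>j<l. x ^ j) = 0" using geometric_sum[OF x1, of l] xl by simp
  then have "3 * ?e (\<Sum>j<l. Q j) = of_int (- int l)"
    by (simp add: Q sum.distrib poly_of_int_poly_simps sum_distrib_left eq_neg_iff_add_eq_0 add.commute)
  then have "3 dvd - int l" by (rule no_third)
  then have "3 dvd l" by presburger
  then have l3: "l = 3" using l(1) by (auto simp: prime_nat_iff)
  define b where "b = ?e (Q 1)"
  have x: "x = 1 + 3 * b" using Q[of 1] by (simp add: b_def)
  have "1 + x + x * x = 0" using sum0 by (simp add: l3 numeral_eq_Suc)
  then have "3 * (3 * (b + b * b) + 1) = 0" by (simp add: x algebra_simps)
  then have "3 * (b + b * b) + 1 = 0" by (metis mult_eq_0_iff zero_neq_numeral)
  then have "3 * ?e (Q 1 + Q 1 * Q 1) = of_int (- 1)"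
    by (simp add: poly_of_int_poly_simps b_def eq_neg_iff_add_eq_0)
  then have "3 dvd (- 1 :: int)" by (rule no_third)
  then show False by simp
qed

text \<open>
  The equation modulo 3 reads \<open>z\<^sup>n\<^sup>+\<^sup>1 \<equiv> 1\<close>, hence \<open>z\<^sup>n\<^sup>+\<^sup>1 = 1\<close>. Then it says that
  \<open>y = (1 + 3 z\<^sup>n) / (1 + 3 z)\<close> is an \<open>n\<close>-th root of unity, and \<open>y \<equiv> 1\<close> gives \<open>z\<^sup>n = z\<close>.
\<close>

lemma root_of_unity_coxeter_equation:
  fixes z :: complex
  assumes z: "z ^ m = 1" "m > 0" and n: "n > 0"
    and eq: "z * (z + 3) ^ n = (3 * z + 1) ^ n"
  shows "z = 1 \<or> z = - 1"
proof -
  have nz: "cmod z = 1" using z by (metis norm_one norm_power power_eq_1_iff norm_ge_zero bot_nat_0.not_eq_extremum)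
  let ?e = "\<lambda>p. poly (of_int_poly p) z"
  \<comment> \<open>Modulo 3 Z[z], \<open>z + 3\<close> is \<open>z\<close> and
    \<open>3 * z + 1\<close> is 1. The next two facts carry this over to powers.\<close>
  have e1: "\<exists>p. (z + 3) ^ k = z ^ k + 3 * ?e p" for k
  proof (induction k)
    case 0
    show ?case by (intro exI[of _ 0]) simp
  next
    case (Suc k)
    then obtain p where "(z + 3) ^ k = z ^ k + 3 * ?e p" by blast
    then have "(z + 3) ^ Suc k = (z + 3) * (z ^ k + 3 * ?e p)" by simp
    also have "\<dots> = z ^ Suc k + 3 * (z * ?e p + z ^ k + 3 * ?e p)" by (simp add: ring_distribs)
    also have "\<dots> = z ^ Suc k + 3 * ?e (monom 1 1 * p + monom 1 k + smult 3 p)"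
      by (simp add: poly_of_int_poly_simps)
    finally show ?case by blast
  qed
  have e2: "\<exists>p. (3 * z + 1) ^ k = 1 + 3 * ?e p" for k
  proof (induction k)
    case 0
    show ?case by (intro exI[of _ 0]) simp
  next
    case (Suc k)
    then obtain p where "(3 * z + 1) ^ k = 1 + 3 * ?e p" by blast
    then have "(3 * z + 1) ^ Suc k = (3 * z + 1) * (1 + 3 * ?e p)" by simp
    also have "\<dots> = 1 + 3 * (3 * (z * ?e p) + z + ?e p)" by (simp add: ring_distribs)
    also have "\<dots> = 1 + 3 * ?e (smult 3 (monom 1 1 * p) + monom 1 1 + p)"
      by (simp add: poly_of_int_poly_simps)
    finally show ?case by blast
  qed
  have zn: "z ^ (n + 1) = 1"
  proof -
    obtain p q where "(z + 3) ^ n = z ^ n + 3 * poly (of_int_poly p) z"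
      "(3 * z + 1) ^ n = 1 + 3 * poly (of_int_poly q) z" using e1 e2 by metis
    with eq have "z ^ (n + 1) + z * (3 * poly (of_int_poly p) z) = 1 + 3 * poly (of_int_poly q) z"
      by (simp add: ring_distribs)
    then have "z ^ (n + 1) = 1 + 3 * poly (of_int_poly (q - monom 1 1 * p)) z"
      by (simp add: poly_of_int_poly_simps algebra_simps)
    moreover have "(z ^ (n + 1)) ^ m = 1"
      using z by (metis power_commutes power_mult power_one mult.commute)
    ultimately show ?thesis using z root_of_unity_cong_1_mod_3[of z m "z ^ (n + 1)" m] by blast
  qed
  have inv: "z * z ^ n = 1" using zn by simp
  have B0: "1 + 3 * z \<noteq> 0"
  proof
    assume "1 + 3 * z = 0"
    then have "z = - 1 / 3" by (simp add: field_simps add_eq_0_iff)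
    then show False using nz by (simp add: norm_divide)
  qed
  define y where "y = (1 + 3 * z ^ n) / (1 + 3 * z)"
  have "z + 3 = z * (1 + 3 * z ^ n)" using inv by (simp add: ring_distribs)
  then have "z * (z ^ n * (1 + 3 * z ^ n) ^ n) = (1 + 3 * z) ^ n"
    using eq by (simp add: power_mult_distrib add.commute)
  then have "(1 + 3 * z ^ n) ^ n = (1 + 3 * z) ^ n" using inv by (simp flip: mult.assoc)
  then have yn: "y ^ n = 1" using B0 by (simp add: y_def power_divide)
  \<comment> \<open>\<open>z\<close> is an (n+1)-th and \<open>y\<close> an n-th root of unity. Both
    are powers of the primitive N-th root \<open>t\<close>, so the congruence for \<open>y\<close>
    can be read in the single ring Z[t].\<close>
  define N where "N = (n + 1) * n"
  have N: "N > 0" using n by (simp add: N_def)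
  define t where "t = cis (2 * pi / N)"
  have gen: "\<exists>k. x = t ^ k" if "x ^ N = 1" for x
  proof -
    have "x \<in> (\<lambda>k. cis (2 * pi * real k / real N)) ` {..<N}"
      using bij_betw_roots_unity[OF N] that by (auto simp: bij_betw_def)
    then show ?thesis by (auto simp: t_def DeMoivre mult_ac)
  qed
  have tN: "t ^ N = 1" using N by (simp add: t_def DeMoivre)
  obtain k l where k: "z = t ^ k" and l: "y = t ^ l"
    using gen[of z] gen[of y] zn yn unfolding N_def
    by (metis mult.commute power_mult power_one)
  have "y = 1 + 3 * poly (of_int_poly (monom 1 (k * n) - monom 1 (k + l))) t"
  proof -
    have "y * (1 + 3 * z) = 1 + 3 * z ^ n" using B0 by (simp add: y_def)
    then have "y = 1 + 3 * (z ^ n - z * y)" by (simp add: algebra_simps)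
    then show ?thesis unfolding k l by (simp add: poly_of_int_poly_simps power_add power_mult)
  qed
  then have "y = 1" using root_of_unity_cong_1_mod_3[OF tN N yn n] by blast
  then have "z ^ n = z" using B0 by (simp add: y_def)
  then have "z * z = 1" using inv by simp
  then show ?thesis by (metis power2_eq_1_iff power2_eq_square)
qed

section \<open>Conjugates of the dominant root\<close>

lemma of_rat_of_int_poly [simp]:
  "map_poly of_rat (of_int_poly p :: rat poly) = (of_int_poly p :: 'a :: field_char_0 poly)"
  by (simp add: map_poly_map_poly o_def)

text \<open>Otherwise split \<open>P = g * h\<close> with \<open>g = gcd(P, q)\<close>. The root
  \<open>s\<close> then belongs to the cofactor \<open>h\<close>, which up to a scalar is monic and
  integral with all its roots in \<open>T\<close> different from \<open>a\<close>; Kronecker's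
  theorem makes \<open>s\<close> a root of unity.\<close>

lemma conjugates_of_int_poly_roots:
  fixes P :: "int poly" and T :: "complex set" and q :: "rat poly"
  assumes P: "of_int_poly P = (\<Prod>s\<in>T. [:- s, 1:])" and fin: "finite T"
    and a: "a \<in> T"
    and T: "\<And>s. s \<in> T \<Longrightarrow> s \<noteq> a \<Longrightarrow> cmod s \<le> 1 \<and> s \<noteq> 0 \<and> (\<forall>m>0. s ^ m \<noteq> 1)"
    and q: "poly (map_poly of_rat q) a = 0" and s: "s \<in> T"
  shows "poly (map_poly of_rat q) s = 0"
proof (rule ccontr)
  assume qs: "poly (map_poly of_rat q) s \<noteq> 0"
  let ?r = "map_poly of_rat :: rat poly \<Rightarrow> complex poly"
  have lcP: "lead_coeff (of_int_poly P :: complex poly) = 1"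
    unfolding P by (rule lead_coeff_prod_linear)
  then have lcP': "lead_coeff P = 1" and P0: "P \<noteq> 0" by auto
  define g where "g = gcd (of_int_poly P) q"
  have "g dvd of_int_poly P" "g dvd q" by (simp_all add: g_def)
  then obtain h where h: "of_int_poly P = g * h" by blast
  interpret rh: map_poly_inj_idom_hom "of_rat :: rat \<Rightarrow> complex" ..
  have rP: "of_int_poly P = ?r g * ?r h"
    using arg_cong[OF h, of ?r] by (simp add: rh.hom_mult)
  have Pt: "poly (of_int_poly P) t = 0 \<longleftrightarrow> t \<in> T" for t
    using fin by (auto simp: P poly_prod)
  \<comment> \<open>Bezout: the common root \<open>a\<close> of \<open>P\<close> and
    \<open>q\<close> is a root of their gcd over the rationals.\<close>
  obtain x y where "bezout_coefficients (of_int_poly P) q = (x, y)" by fastforce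
  then have "g = x * of_int_poly P + y * q" using bezout_coefficients unfolding g_def by metis
  from arg_cong[OF this, of ?r] have ga: "poly (?r g) a = 0"
    using q a Pt[of a] by (simp add: rh.hom_mult rh.hom_add)
  have gs: "poly (?r g) s \<noteq> 0"
  proof
    assume "poly (?r g) s = 0"
    moreover obtain q' where "q = g * q'" using \<open>g dvd q\<close> by blast
    ultimately show False using qs by (simp add: rh.hom_mult)
  qed
  \<comment> \<open>Gauss's lemma: \<open>P\<close> is monic, hence of content 1, so the normalized
    integer forms of \<open>g\<close> and \<open>h\<close> multiply to \<open>P\<close> itself.
    Their leading coefficients are 1 or -1, and \<open>k\<close> corrects the sign.\<close>
  obtain c g' where g': "rat_to_normalized_int_poly g = (c, g')" by fastforce
  obtain d h' where h': "rat_to_normalized_int_poly h = (d, h')" by fastforce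
  note hd = rat_to_normalized_int_poly(1,2,4)[OF h']
  have "content P dvd lead_coeff P" by (rule content_dvd_coeff)
  then have "content P = 1" using lcP' by (simp add: is_unit_content_iff)
  from rat_to_int_factor_content_1[OF this h g' h' P0] have "P = g' * h'" .
  then have "lead_coeff g' * lead_coeff h' = 1" using lcP' by (simp add: lead_coeff_mult)
  then have lch: "lead_coeff h' * lead_coeff h' = 1" by (auto simp: zmult_eq_1_iff)
  then have h'0: "h' \<noteq> 0" by (metis mult_zero_left zero_neq_one coeff_0)
  define k where "k = smult (lead_coeff h') h'"
  have lck: "lead_coeff k = 1" using lch h'0 by (simp add: k_def)
  have degk: "degree k = degree h" unfolding k_def using h'0 hd(3) by (metis degree_smult_eq leading_coeff_0_iff)
  have rh: "?r h = smult (of_rat d) (of_int_poly h')" using arg_cong[OF hd(1), of ?r]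
    by (simp add: hom_distribs)
  have kh: "poly (of_int_poly k) t = 0 \<longleftrightarrow> poly (?r h) t = 0" for t
    using hd(2) h'0 by (simp add: rh k_def poly_of_int_poly_simps)
  \<comment> \<open>\<open>G\<close> and \<open>H\<close> cover \<open>T\<close>, and their sizes
    are at most the degrees of \<open>g\<close> and \<open>h\<close>, which add up to
    \<open>card T\<close>. Hence they are disjoint and \<open>h\<close> has exactly the simple roots
    \<open>H\<close>.\<close>
  define G where "G = {t \<in> T. poly (?r g) t = 0}"
  define H where "H = {t \<in> T. poly (?r h) t = 0}"
  have g0: "?r g \<noteq> 0" "?r h \<noteq> 0" using lcP unfolding rP by auto
  have "card G \<le> card {t. poly (?r g) t = 0}" "card H \<le> card {t. poly (?r h) t = 0}"
    unfolding G_def H_def using g0 poly_roots_finite by (auto intro!: card_mono)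
  then have le: "card G \<le> degree (?r g)" "card H \<le> degree (?r h)"
    using card_poly_roots_bound[OF g0(1)] card_poly_roots_bound[OF g0(2)] by linarith+
  have deg: "degree (?r g) + degree (?r h) = card T"
  proof -
    have "degree (of_int_poly P :: complex poly) = card T"
      unfolding P by (rule degree_prod_linear[OF fin])
    then show ?thesis unfolding rP degree_mult_eq[OF g0] .
  qed
  have fGH: "finite G" "finite H" using fin by (auto simp: G_def H_def)
  have "G \<union> H = T"
    using Pt unfolding rP G_def H_def by auto
  then have "card T + card (G \<inter> H) = card G + card H" using card_Un_Int[OF fGH] by simp
  then have cGH: "card (G \<inter> H) = 0" "card H = degree (?r h)" using le deg by linarith+
  then have "G \<inter> H = {}" using fGH by simp
  then have aH: "a \<notin> H" using ga a by (auto simp: G_def)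
  have sH: "s \<in> H" using \<open>G \<union> H = T\<close> s gs by (auto simp: G_def)
  have "of_int_poly k = (\<Prod>s\<in>H. [:- s, 1:])"
  proof (rule poly_eqI_degree_lead_coeff[of _ "card H" _ H])
    show "degree (of_int_poly k :: complex poly) \<le> card H" using cGH degk by simp
    show "degree (\<Prod>s\<in>H. [:- s, 1:]) \<le> card H" using degree_prod_linear[OF fGH(2)] by simp
    show "coeff (of_int_poly k) (card H) = coeff (\<Prod>s\<in>H. [:- s, 1:]) (card H)"
      using lead_coeff_prod_linear[of H] lck cGH degk
      unfolding degree_prod_linear[OF fGH(2)] by simp
    show "poly (of_int_poly k) z = poly (\<Prod>s\<in>H. [:- s, 1:]) z" if "z \<in> H" for z
    proof -
      have "poly (of_int_poly k) z = 0" using that kh by (simp add: H_def)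
      moreover have "poly (\<Prod>s\<in>H. [:- s, 1:]) z = 0" using that fGH(2) by (auto simp: poly_prod)
      ultimately show ?thesis by simp
    qed
  qed simp
  then have "\<exists>m>0. s ^ m = 1"
  proof (rule kronecker_root_of_unity[OF _ fGH(2) _ sH])
    show "cmod t \<le> 1" if "t \<in> H" for t using T[of t] that aH by (auto simp: H_def)
    show "s \<noteq> 0" using T[OF s] sH aH by auto
  qed
  then show False using T[OF s] sH aH by auto
qed

section \<open>Eigenvalues of the Coxeter element\<close>

lemma dim_refl_mat [simp]: "dim_row (refl_mat n i) = n" "dim_col (refl_mat n i) = n"
  by (simp_all add: refl_mat_def)

lemma dim_geom_rep [simp]: "dim_row (geom_rep n w) = n" "dim_col (geom_rep n w) = n"
  by (rule carrier_matD[OF geom_rep_carrier])+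

lemma refl_mat_index:
  assumes "i < n" "j < n" "k < n"
  shows "refl_mat n i $$ (j, k) = (if j = k then 1 else 0) + (if j = i then if k = i then -2 else 2 else 0)"
  using assms by (auto simp: refl_mat_def reflection_def formB_unit_vec)

text \<open>\<open>B(x, e_i)\<close> is the sum of all coordinates minus \<open>2 * x_i\<close>, and
  twice this is added to \<open>x_i\<close>.\<close>

lemma map_refl_mat_mult_vec:
  fixes x :: "'a :: comm_ring_1 vec"
  assumes "x \<in> carrier_vec n" "i < n" "j < n"
  shows "(map_mat of_int (refl_mat n i) *\<^sub>v x) $ j =
    (if j = i then 2 * (\<Sum>k<n. x $ k) - 3 * x $ i else x $ j)"
proof -
  have "(map_mat of_int (refl_mat n i) *\<^sub>v x) $ j =
      (\<Sum>k<n. of_int (refl_mat n i $$ (j, k)) * x $ k)"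
    using assms by (simp add: scalar_prod_def lessThan_atLeast0)
  also have "\<dots> = (\<Sum>k<n. (if j = k then x $ k else 0) +
      (if j = i then 2 * x $ k - (if k = i then 4 * x $ k else 0) else 0))"
    using assms by (intro sum.cong) (auto simp: refl_mat_index algebra_simps)
  also have "\<dots> = (if j = i then 2 * (\<Sum>k<n. x $ k) - 3 * x $ i else x $ j)"
    using assms by (simp add: sum.distrib sum_subtractf sum_distrib_left)
  finally show ?thesis .
qed

text \<open>
  The reflection \<open>s\<^sub>m\<close> changes only the coordinate \<open>m\<close>, so the Coxeter element multiplies the
  coordinates by \<open>l\<close> one at a time, starting with the last.
\<close>

lemma coxeter_partial_eigenvector:
  fixes w l :: "'a :: field"
  assumes w1: "w \<noteq> 1" and l1: "l * w ^ n = 1" and l2: "l * (3 * w - 1) = 3 - w" and m: "m \<le> n"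
  shows "map_mat of_int (geom_rep n [m..<n]) *\<^sub>v vec n (\<lambda>j. w ^ j) =
    vec n (\<lambda>j. if j < m then w ^ j else l * w ^ j)"
  using m
proof (induction rule: inc_induct)
  case base
  show ?case by (simp add: geom_rep_def of_int_hom.mat_hom_one) auto
next
  case (step m)
  let ?R = "map_mat of_int (refl_mat n m) :: 'a mat" and ?G = "map_mat of_int (geom_rep n [Suc m..<n]) :: 'a mat"
  let ?y = "vec n (\<lambda>j. if j < Suc m then w ^ j else l * w ^ j)"
  have "geom_rep n [m..<n] = refl_mat n m * geom_rep n [Suc m..<n]"
    using step.hyps by (simp add: geom_rep_def upt_conv_Cons)
  then have "map_mat of_int (geom_rep n [m..<n]) = ?R * ?G"
    by (simp add: of_int_hom.mat_hom_mult[OF refl_mat_carrier geom_rep_carrier])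
  then have eq: "map_mat of_int (geom_rep n [m..<n]) *\<^sub>v vec n (\<lambda>j. w ^ j) = ?R *\<^sub>v ?y"
    using assoc_mult_mat_vec[of ?R n n ?G n "vec n (\<lambda>j. w ^ j)"] step.IH by simp
  \<comment> \<open>Coordinates up to \<open>m\<close> are still unscaled, the later ones already
    carry \<open>l\<close>. Both geometric sums are evaluated after multiplication by
    \<open>w - 1\<close>.\<close>
  have split: "{..<n} = {..<Suc m} \<union> {Suc m..<n}" using step.hyps by auto
  have "(\<Sum>k<n. ?y $ k) = (\<Sum>k<Suc m. w ^ k) + l * (\<Sum>k=Suc m..<n. w ^ k)"
    unfolding split sum_distrib_left using step.hyps
    by (subst sum.union_disjoint) (auto intro!: arg_cong2[where f = plus] sum.cong)
  moreover have "(w - 1) * (\<Sum>k<Suc m. w ^ k) = w ^ Suc m - 1"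
    by (rule power_diff_1_eq[symmetric])
  moreover have "(w - 1) * (\<Sum>k=Suc m..<n. w ^ k) = w ^ n - w ^ Suc m"
  proof -
    have "(w - 1) * (\<Sum>k<n. w ^ k) = w ^ n - 1" by (rule power_diff_1_eq[symmetric])
    moreover have "(\<Sum>k<n. w ^ k) = (\<Sum>k<Suc m. w ^ k) + (\<Sum>k=Suc m..<n. w ^ k)"
      unfolding split by (rule sum.union_disjoint) auto
    ultimately have "(w - 1) * (\<Sum>k<Suc m. w ^ k) + (w - 1) * (\<Sum>k=Suc m..<n. w ^ k) = w ^ n - 1"
      by (simp only: distrib_left)
    then show ?thesis unfolding power_diff_1_eq[of w "Suc m", symmetric]
      by (simp only: eq_diff_eq diff_add_eq add.commute) simp
  qed
  ultimately have "(w - 1) * (\<Sum>k<n. ?y $ k) = (w ^ Suc m - 1) + l * (w ^ n - w ^ Suc m)"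
    by (simp only: ring_distribs(1) mult.left_commute[of "w - 1" l])
  moreover have "(w - 1) * (2 * S - 3 * w ^ m) = 2 * ((w - 1) * S) - 3 * w ^ m * (w - 1)" for S
    by (simp add: algebra_simps)
  ultimately have "(w - 1) * (2 * (\<Sum>k<n. ?y $ k) - 3 * w ^ m) =
      2 * ((w ^ Suc m - 1) + (l * w ^ n - l * w ^ Suc m)) - 3 * w ^ m * (w - 1)"
    by (simp only: right_diff_distrib)
  \<comment> \<open>\<open>l1\<close> cancels the constant terms; \<open>l2\<close> then turns the
    rest into a multiple of \<open>w - 1\<close>.\<close>
  also have "\<dots> = w ^ m * ((3 - w) - l * (2 * w))" unfolding l1 by (simp add: ring_distribs mult_ac)
  also have "\<dots> = (w - 1) * (l * w ^ m)" unfolding l2[symmetric] by (simp add: ring_distribs mult_ac)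
  finally have key: "2 * (\<Sum>k<n. ?y $ k) - 3 * w ^ m = l * w ^ m" using w1 by simp
  show ?case unfolding eq
  proof (rule eq_vecI)
    fix j assume "j < dim_vec (vec n (\<lambda>j. if j < m then w ^ j else l * w ^ j))"
    then have j: "j < n" by simp
    show "(?R *\<^sub>v ?y) $ j = vec n (\<lambda>j. if j < m then w ^ j else l * w ^ j) $ j"
      using j step.hyps key by (subst map_refl_mat_mult_vec[of _ n m j]) auto
  qed simp
qed

lemma coxeter_eigenvalue:
  fixes w l :: "'a :: field_char_0"
  assumes "w \<noteq> 1" "l * w ^ n = 1" "l * (3 * w - 1) = 3 - w" "n > 0"
  shows "eigenvalue (map_mat of_int (geom_rep n [0..<n])) l"
  unfolding eigenvalue_def eigenvector_def
proof (intro exI conjI)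
  let ?v = "vec n (\<lambda>j. w ^ j)"
  have d: "dim_row (map_mat of_int (geom_rep n [0..<n])) = n" by simp
  show "?v \<in> carrier_vec (dim_row (map_mat of_int (geom_rep n [0..<n])))" unfolding d by simp
  show "?v \<noteq> 0\<^sub>v (dim_row (map_mat of_int (geom_rep n [0..<n])))"
  proof
    assume "?v = 0\<^sub>v (dim_row (map_mat of_int (geom_rep n [0..<n])))"
    then have "?v $ 0 = 0\<^sub>v n $ 0" unfolding d by simp
    then show False using assms(4) by simp
  qed
  show "map_mat of_int (geom_rep n [0..<n]) *\<^sub>v ?v = l \<cdot>\<^sub>v ?v"
    unfolding coxeter_partial_eigenvector[OF assms(1-3) le0] by auto
qed

section \<open>Solutions of the eigenvalue equation on the circle and on the real line\<close>

lemma cis_diff_cis: "cis a - cis b = 2 * \<i> * sin ((a - b) / 2) * cis ((a + b) / 2)"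
proof -
  have "(b - a) / 2 = - ((a - b) / 2)" by simp
  then have "sin ((b - a) / 2) = - sin ((a - b) / 2)" by (simp only: sin_minus)
  then show ?thesis by (simp add: complex_eq_iff cos_diff_cos sin_diff_sin)
qed

text \<open>With \<open>w = cis t\<close> the two sides differ by
  \<open>3 * (w^n - w) - (w^(n+1) - 1)\<close>. Both differences have the factor
  \<open>2 * i * cis ((n + 1) * t / 2)\<close>, which leaves the two sines.\<close>

lemma cis_coxeter_equation:
  assumes "sin ((real n + 1) * t / 2) = 3 * sin ((real n - 1) * t / 2)"
  shows "cis t ^ n * (3 - cis t) = 3 * cis t - 1"
proof -
  have "cis t ^ n * (3 - cis t) - (3 * cis t - 1) =
      3 * (cis (real n * t) - cis t) - (cis ((real n + 1) * t) - cis 0)"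
    by (simp add: DeMoivre algebra_simps cis_mult)
  also have "cis (real n * t) - cis t = 2 * \<i> * sin ((real n - 1) * t / 2) * cis ((real n + 1) * t / 2)"
    by (simp add: cis_diff_cis algebra_simps)
  also have "cis ((real n + 1) * t) - cis 0 = 2 * \<i> * sin ((real n + 1) * t / 2) * cis ((real n + 1) * t / 2)"
    by (simp only: cis_diff_cis) simp
  finally show ?thesis by (simp add: assms)
qed

lemma cis_inj_on: "inj_on cis {0<..<2 * pi}"
proof (rule inj_onI)
  fix a b assume ab: "a \<in> {0<..<2 * pi}" "b \<in> {0<..<2 * pi}" "cis a = cis b"
  then have "cis (a - b) = 1" by (simp flip: cis_divide)
  then have "cos (a - b) = 1" by (simp add: complex_eq_iff)
  then obtain k :: int where k: "a - b = real_of_int k * 2 * pi" unfolding cos_one_2pi_int by blast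
  have "\<bar>a - b\<bar> < 2 * pi" using ab(1,2) by (auto simp: abs_less_iff)
  then have "\<bar>real_of_int k\<bar> * (2 * pi) < 1 * (2 * pi)" unfolding k by (simp add: abs_mult)
  then have "\<bar>real_of_int k\<bar> < 1" by simp
  then have "k = 0" by linarith
  then show "a = b" using k by simp
qed

text \<open>The points \<open>p 0\<close>, ..., \<open>p (n - 2)\<close> lie strictly between 0 and
  2 pi and bound \<open>n - 2\<close> intervals. A sign change gives a root in each, and
  \<open>cis\<close> keeps these roots apart.\<close>

lemma coxeter_circle_roots:
  assumes n: "n \<ge> 3"
  shows "\<exists>U. finite U \<and> card U = n - 2 \<and>
    (\<forall>u\<in>U. cmod u = 1 \<and> u \<noteq> 1 \<and> u ^ n * (3 - u) = 3 * u - 1)"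
proof -
  \<comment> \<open>\<open>f\<close> alternates in sign along the points \<open>p k\<close>, where the second sine is \<open>\<plusminus>1\<close>.\<close>
  define f where "f t = sin ((real n + 1) * t / 2) - 3 * sin ((real n - 1) * t / 2)" for t
  define p where "p k = real (2 * k + 1) * pi / (real n - 1)" for k :: nat
  have cont: "continuous_on S f" for S unfolding f_def by (intro continuous_intros) auto
  have sp: "sin ((real n - 1) * p k / 2) = (- 1) ^ k" for k
  proof -
    have "(real n - 1) * p k / 2 = real k * pi + pi / 2" using n by (simp add: p_def field_simps)
    then show ?thesis by (simp add: sin_add)
  qed
  have even_neg: "f (p k) < 0" if "even k" for k
  proof -
    have "f (p k) = sin ((real n + 1) * p k / 2) - 3" using that sp[of k] by (simp add: f_def)
    then show ?thesis using sin_le_one[of "(real n + 1) * p k / 2"] by linarith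
  qed
  have odd_pos: "f (p k) > 0" if "odd k" for k
  proof -
    have "f (p k) = sin ((real n + 1) * p k / 2) + 3" using that sp[of k] by (simp add: f_def)
    then show ?thesis using sin_ge_minus_one[of "(real n + 1) * p k / 2"] by linarith
  qed
  have pmono: "p k \<le> p l" if "k \<le> l" for k l
    using that n by (simp add: p_def divide_right_mono)
  have "\<exists>t. p k < t \<and> t < p (Suc k) \<and> f t = 0" for k
  proof -
    have "\<exists>t\<ge>p k. t \<le> p (Suc k) \<and> f t = 0"
    proof (cases "even k")
      case True
      then show ?thesis using IVT'[of f "p k" 0 "p (Suc k)"] even_neg[of k] odd_pos[of "Suc k"] pmono[of k "Suc k"] cont
        by auto
    next
      case False
      then show ?thesis using IVT2'[of f "p (Suc k)" 0 "p k"] odd_pos[of k] even_neg[of "Suc k"] pmono[of k "Suc k"] cont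
        by auto
    qed
    \<comment> \<open>Since \<open>f\<close> does not vanish at the endpoints, the zeros lie
      strictly inside their intervals and \<open>t\<close> is strictly increasing.\<close>
    moreover have "f (p l) \<noteq> 0" for l using even_neg[of l] odd_pos[of l] by (cases "even l") auto
    ultimately show ?thesis by (metis order_le_less)
  qed
  then obtain t where t: "\<And>k. p k < t k" "\<And>k. t k < p (Suc k)" "\<And>k. f (t k) = 0" by metis
  have "strict_mono t"
    using t pmono by (intro strict_mono_Suc_iff[THEN iffD2] allI) (meson less_trans)
  then have inj_t: "inj t" by (rule strict_mono_imp_inj_on)
  have rng: "t k \<in> {0<..<2 * pi}" if "k < n - 2" for k
  proof -
    have "0 < p 0" using n by (simp add: p_def)
    moreover have "p (n - 2) < 2 * pi"
      using n by (simp add: p_def field_simps of_nat_diff)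
    moreover have "p 0 \<le> p k" "p (Suc k) \<le> p (n - 2)" using that by (auto intro!: pmono)
    ultimately show ?thesis using t(1,2)[of k] by auto
  qed
  define U where "U = (\<lambda>k. cis (t k)) ` {..<n - 2}"
  have inj: "inj_on (\<lambda>k. cis (t k)) {..<n - 2}"
    using rng by (intro inj_onI) (auto dest!: inj_onD[OF cis_inj_on] injD[OF inj_t])
  have ne1: "cis (t k) \<noteq> 1" if "k < n - 2" for k
  proof
    assume "cis (t k) = 1"
    then have "cos (t k) = 1" by (simp add: complex_eq_iff)
    then obtain j :: int where "t k = real_of_int j * 2 * pi" unfolding cos_one_2pi_int by blast
    with rng[OF that] have "0 < real_of_int j * (2 * pi)" "real_of_int j * (2 * pi) < 1 * (2 * pi)" by auto
    then have "0 < real_of_int j" "real_of_int j < 1"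
      by (auto simp: zero_less_mult_iff)
    then have "0 < j" "j < 1" by (simp_all only: of_int_0_less_iff of_int_less_1_iff)
    then show False by simp
  qed
  have "u ^ n * (3 - u) = 3 * u - 1" if "u \<in> U" for u
    using that t(3) by (auto simp: U_def f_def intro!: cis_coxeter_equation)
  then show ?thesis
    using card_image[OF inj] ne1 by (intro exI[of _ U]) (auto simp: U_def)
qed

text \<open>The difference of the two sides is \<open>2^n - 5 > 0\<close> at 2 and -8 at 3.\<close>

lemma coxeter_real_root:
  assumes n: "n \<ge> 3"
  shows "\<exists>u::real. 2 < u \<and> u < 3 \<and> u ^ n * (3 - u) = 3 * u - 1"
proof -
  define f where "f u = u ^ n * (3 - u) - (3 * u - 1)" for u :: real
  have "(2::real) ^ 3 \<le> 2 ^ n" using n by (intro power_increasing) auto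
  then have "f 2 > 0" "f 3 < 0" by (auto simp: f_def)
  moreover have "continuous_on {2..3} f" unfolding f_def by (intro continuous_intros)
  ultimately obtain u where "2 \<le> u" "u \<le> 3" "f u = 0" using IVT2'[of f 3 0 2] by auto
  with \<open>f 2 > 0\<close> \<open>f 3 < 0\<close> show ?thesis
    by (intro exI[of _ u]) (auto simp: f_def order_le_less)
qed

text \<open>The \<open>n\<close> solutions \<open>w\<close> (a real reciprocal pair and
  \<open>n - 2\<close> points of the circle) are mapped to eigenvalues by the Moebius map
  \<open>(3 - w) / (3 * w - 1)\<close>. Its injectivity keeps them distinct.\<close>

lemma coxeter_spectrum:
  assumes n: "n \<ge> 3"
  obtains a :: real and S :: "complex set" where
    "a > 1" "finite S" "card S = n" "of_real a \<in> S" "of_real (1 / a) \<in> S"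
    "\<And>s. s \<in> S \<Longrightarrow> s \<noteq> of_real a \<Longrightarrow> s \<noteq> of_real (1 / a) \<Longrightarrow> cmod s = 1"
    "\<And>s. s \<in> S \<Longrightarrow> s \<noteq> 1 \<and> s * (s + 3) ^ n = (3 * s + 1) ^ n"
    "\<And>s. s \<in> S \<Longrightarrow> eigenvalue (map_mat of_int (geom_rep n [0..<n])) s"
proof -
  obtain U where U: "finite U" "card U = n - 2"
    "\<And>w. w \<in> U \<Longrightarrow> cmod w = 1 \<and> w \<noteq> 1 \<and> w ^ n * (3 - w) = 3 * w - 1"
    using coxeter_circle_roots[OF n] by blast
  obtain u :: real where u: "2 < u" "u < 3" "u ^ n * (3 - u) = 3 * u - 1"
    using coxeter_real_root[OF n] by blast
  define c where "c = (of_real u :: complex)"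
  have c_eq: "c ^ n * (3 - c) = 3 * c - 1"
    using arg_cong[OF u(3), of complex_of_real] by (simp add: c_def)
  have c0: "c \<noteq> 0" "c \<noteq> 1" "1 / c \<noteq> 1" "c \<noteq> 1 / c"
  proof -
    have "1 / u < 1" using u by simp
    then have "u \<noteq> 1 / u" using u by linarith
    then show "c \<noteq> 1 / c" unfolding c_def by (metis of_real_1 of_real_divide of_real_eq_iff)
  qed (use u in \<open>auto simp: c_def\<close>)
  \<comment> \<open>The equation is reciprocal: it is invariant under \<open>w\<close> to
    \<open>1 / w\<close>.\<close>
  have ci_eq: "(1 / c) ^ n * (3 - 1 / c) = 3 * (1 / c) - 1"
  proof -
    have "(1 / c) ^ n * (3 - 1 / c) = (3 * c - 1) / (c * c ^ n)"
      using c0(1) by (simp add: power_divide field_simps)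
    also have "\<dots> = 3 * (1 / c) - 1"
      unfolding c_eq[symmetric] using c0(1) by (simp add: field_simps)
    finally show ?thesis .
  qed
  define W where "W = insert c (insert (1 / c) U)"
  have W: "w \<noteq> 1 \<and> w ^ n * (3 - w) = 3 * w - 1" if "w \<in> W" for w
    using that U(3) c_eq ci_eq c0 by (auto simp: W_def)
  have cU: "c \<notin> U" "1 / c \<notin> U"
    using U(3)[of c] U(3)[of "1 / c"] u by (auto simp: c_def norm_divide)
  have cardW: "card W = n" "finite W"
    using n U cU c0 by (simp_all add: W_def)
  define l where "l w = (3 - w) / (3 * w - 1)" for w :: complex
  have nz: "3 * w - 1 \<noteq> 0" if "w \<in> W" for w
  proof
    assume w: "3 * w - 1 = 0"
    then have "w ^ n * (3 - w) = 0" using W[OF that] by simp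
    then have "w = 0 \<or> w = 3" by auto
    with w show False by auto
  qed
  have inj: "inj_on l W"
  proof (rule inj_onI)
    fix v w assume vw: "v \<in> W" "w \<in> W" "l v = l w"
    then have "(3 - v) * (3 * w - 1) = (3 - w) * (3 * v - 1)"
      using nz by (simp add: l_def frac_eq_eq)
    then show "v = w" by (simp add: algebra_simps)
  qed
  \<comment> \<open>The large eigenvalue belongs to the small solution \<open>1 / c\<close>, and
    \<open>c\<close> gives its inverse.\<close>
  define a where "a = (3 * u - 1) / (3 - u)"
  have lc: "l (1 / c) = of_real a" "l c = of_real (1 / a)"
    using u by (simp_all add: l_def a_def c_def field_simps)
  show ?thesis
  proof (rule that[of a "l ` W"])
    show "a > 1" using u by (simp add: a_def)
    show "finite (l ` W)" "card (l ` W) = n" using cardW card_image[OF inj] by simp_all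
    show "of_real a \<in> l ` W" "of_real (1 / a) \<in> l ` W"
      unfolding lc[symmetric] by (auto simp: W_def)
  next
    fix s assume "s \<in> l ` W"
    then obtain w where w: "w \<in> W" "s = l w" by blast
    have l2: "s * (3 * w - 1) = 3 - w" using nz[OF w(1)] by (simp add: w(2) l_def)
    have "s * w ^ n * (3 * w - 1) = w ^ n * (3 - w)" using l2 by (metis mult.assoc mult.commute)
    then have l1: "s * w ^ n = 1" using W[OF w(1)] nz[OF w(1)] by simp
    show "eigenvalue (map_mat of_int (geom_rep n [0..<n])) s"
      using coxeter_eigenvalue[OF _ l1 l2] W[OF w(1)] n by simp
    have "s \<noteq> 1"
    proof
      assume "s = 1"
      with l2 have "w = 1" by (simp add: algebra_simps)
      then show False using W[OF w(1)] by simp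
    qed
    \<comment> \<open>Solving the Moebius relation for \<open>w\<close> and inserting it into
      \<open>s * w ^ n = 1\<close> eliminates \<open>w\<close>.\<close>
    moreover have "s + 3 = w * (3 * s + 1)" using l2 by (simp add: algebra_simps)
    then have "s * (s + 3) ^ n = (s * w ^ n) * (3 * s + 1) ^ n" by (simp add: power_mult_distrib)
    ultimately show "s \<noteq> 1 \<and> s * (s + 3) ^ n = (3 * s + 1) ^ n" using l1 by simp
    assume "s \<noteq> of_real a" "s \<noteq> of_real (1 / a)"
    then have "w \<in> U" using w lc by (auto simp: W_def)
    then have w1: "cmod w = 1" using U(3) by blast
    \<comment> \<open>On the unit circle \<open>w * cnj w = 1\<close>, so numerator and denominator
      of \<open>l w\<close> have equal modulus.\<close>
    have "w * (3 - cnj w) = 3 * w - 1"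
      using w1 complex_norm_square[of w] by (simp add: algebra_simps)
    then have "cmod (3 * w - 1) = cmod (3 - cnj w)" using w1 by (metis mult_1 norm_mult)
    also have "\<dots> = cmod (cnj (3 - w))" by simp
    also have "\<dots> = cmod (3 - w)" by (rule complex_mod_cnj)
    finally have eq: "cmod (3 - w) = cmod (3 * w - 1)" by (rule sym)
    show "cmod s = 1" unfolding w(2) l_def norm_divide eq using nz[OF w(1)] by simp
  qed
qed

section \<open>Powers of the Coxeter element and Salem polynomials\<close>

text \<open>Choose one colliding exponent for each pair, or 1 if there is none; the product over all
  pairs works for all of them at once.\<close>

lemma finite_common_power_collisions:
  fixes S :: "'a :: field set"
  assumes "finite S"
  obtains N :: nat where "N > 0" "\<And>s t m. s \<in> S \<Longrightarrow> t \<in> S \<Longrightarrow> m > 0 \<Longrightarrow> s ^ m = t ^ m \<Longrightarrow> s ^ N = t ^ N"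
proof -
  have "\<exists>k>0. \<forall>m>0. s ^ m = t ^ m \<longrightarrow> s ^ k = t ^ k" for s t :: 'a
    by (cases "\<exists>m>0. s ^ m = t ^ m") (blast, auto intro: exI[of _ 1])
  then obtain f :: "'a \<Rightarrow> 'a \<Rightarrow> nat" where
    f: "\<And>s t. f s t > 0" "\<And>s t m. m > 0 \<Longrightarrow> s ^ m = t ^ m \<Longrightarrow> s ^ f s t = t ^ f s t"
    by metis
  define N where "N = (\<Prod>s\<in>S. \<Prod>t\<in>S. f s t)"
  show ?thesis
  proof (rule that)
    show "N > 0" unfolding N_def using f by (intro prod_pos) auto
    fix s t m assume st: "s \<in> S" "t \<in> S" "m > 0" "s ^ m = t ^ m"
    have "f s t dvd (\<Prod>t\<in>S. f s t)" "(\<Prod>t\<in>S. f s t) dvd N"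
      unfolding N_def using assms st by (auto intro: dvd_prodI)
    then obtain k where "N = f s t * k" by (metis dvd_trans dvdE)
    then show "s ^ N = t ^ N" using f(2)[OF st(3,4)] by (simp add: power_mult)
  qed
qed

text \<open>A collision at exponent \<open>N * j + 1\<close> forces \<open>s ^ N = t ^ N\<close>;
  cancelling the nonzero factor \<open>s ^ (N * j)\<close> leaves \<open>s = t\<close>.\<close>

lemma inj_on_power_if_collisions:
  fixes S :: "'a :: field set"
  assumes N: "\<And>s t m. s \<in> S \<Longrightarrow> t \<in> S \<Longrightarrow> m > 0 \<Longrightarrow> s ^ m = t ^ m \<Longrightarrow> s ^ N = t ^ N"
    and S0: "0 \<notin> S"
  shows "inj_on (\<lambda>s. s ^ Suc (N * j)) S"
proof (rule inj_onI)
  fix s t assume st: "s \<in> S" "t \<in> S" "s ^ Suc (N * j) = t ^ Suc (N * j)"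
  then have "s ^ N = t ^ N" using N by blast
  then have "s ^ (N * j) = t ^ (N * j)" by (simp add: power_mult)
  then have "s * s ^ (N * j) = t * s ^ (N * j)" using st(3) by simp
  moreover have "s ^ (N * j) \<noteq> 0" using st(1) S0 by auto
  ultimately show "s = t" by (metis mult_right_cancel)
qed

text \<open>Both sides are monic of degree \<open>n\<close> and vanish at the \<open>n\<close>
  points of \<open>T\<close>.\<close>

lemma char_poly_of_eigenvalues:
  fixes A :: "int mat" and T :: "'a :: field_char_0 set"
  assumes A: "A \<in> carrier_mat n n" and T: "finite T" "card T = n"
    and ev: "\<And>t. t \<in> T \<Longrightarrow> eigenvalue (map_mat of_int A) t"
  shows "of_int_poly (char_poly A) = (\<Prod>t\<in>T. [:- t, 1:])"
proof (rule poly_eqI_degree_lead_coeff[of _ n _ T])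
  note d = degree_monic_char_poly[OF A]
  show "coeff (of_int_poly (char_poly A)) n = coeff (\<Prod>t\<in>T. [:- t, 1:]) n"
    using d lead_coeff_prod_linear[of T] unfolding degree_prod_linear[OF T(1)] T(2) by simp
  show "degree (of_int_poly (char_poly A) :: 'a poly) \<le> n" using d by simp
  show "degree (\<Prod>t\<in>T. [:- t, 1:]) \<le> n" using degree_prod_linear[OF T(1)] T(2) by simp
  fix z assume z: "z \<in> T"
  have "poly (char_poly (map_mat of_int A)) z = 0"
    using ev[OF z] eigenvalue_root_char_poly[of "map_mat of_int A" n z] A by auto
  then have "poly (of_int_poly (char_poly A)) z = 0"
    by (simp add: of_int_hom.char_poly_hom[OF A])
  moreover have "poly (\<Prod>t\<in>T. [:- t, 1:]) z = 0" using z T(1) by (auto simp: poly_prod)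
  ultimately show "poly (of_int_poly (char_poly A)) z = poly (\<Prod>t\<in>T. [:- t, 1:]) z" by simp
qed (simp add: T)

lemma eigenvector_pow_mat:
  assumes A: "A \<in> carrier_mat n n" and ev: "eigenvector A v k"
  shows "eigenvector (A ^\<^sub>m i) v (k ^ i)"
  using eigenvector_pow[OF A ev, of i] ev A unfolding eigenvector_def by auto

text \<open>On an eigenvector for \<open>a\<close> the powers act by the scalars
  \<open>a ^ k\<close>, which are distinct because \<open>a > 1\<close>.\<close>

lemma inj_pow_mat_of_eigenvalue:
  fixes A :: "int mat" and a :: real
  assumes A: "A \<in> carrier_mat n n" and a: "a > 1"
    and ev: "eigenvalue (map_mat of_int A) (complex_of_real a)"
  shows "inj (\<lambda>k. A ^\<^sub>m k)"
proof (rule injI)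
  fix k l assume eq: "A ^\<^sub>m k = A ^\<^sub>m l"
  let ?A = "map_mat of_int A :: complex mat"
  have cA: "?A \<in> carrier_mat n n" using A by simp
  obtain v where v: "eigenvector ?A v (of_real a)" using ev by (auto simp: eigenvalue_def)
  then have vn: "v \<in> carrier_vec n" "v \<noteq> 0\<^sub>v n" using A by (auto simp: eigenvector_def)
  have "?A ^\<^sub>m k = ?A ^\<^sub>m l"
    using arg_cong[OF eq, of "map_mat of_int"] by (simp add: of_int_hom.mat_hom_pow[OF A])
  then have vkl: "of_real a ^ k \<cdot>\<^sub>v v = of_real a ^ l \<cdot>\<^sub>v v"
    using eigenvector_pow[OF cA v, of k] eigenvector_pow[OF cA v, of l] by simp
  obtain i where i: "i < n" "v $ i \<noteq> 0"
  proof (rule ccontr)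
    assume "\<not> thesis"
    then have "v = 0\<^sub>v n" using vn(1) that by (intro eq_vecI) auto
    then show False using vn by simp
  qed
  have "(complex_of_real a ^ k \<cdot>\<^sub>v v) $ i = (complex_of_real a ^ l \<cdot>\<^sub>v v) $ i" by (simp add: vkl)
  then have "complex_of_real a ^ k = complex_of_real a ^ l" using i vn(1) by simp
  then have "a ^ k = a ^ l" by (metis of_real_eq_iff of_real_power)
  then show "k = l" using a by (metis power_inject_exp)
qed

text \<open>By \<open>conj\<close>, a nonzero rational polynomial vanishing at \<open>b\<close> has
  all of \<open>T\<close> among its roots, hence degree at least that of \<open>P\<close>. So
  \<open>P\<close> is the minimal polynomial of \<open>b\<close>, and \<open>T\<close> is its set of
  conjugates.\<close>

lemma salem_poly_criterion:
  fixes P :: "int poly" and b :: real and T :: "complex set"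
  assumes P: "of_int_poly P = (\<Prod>t\<in>T. [:- t, 1:])" and T: "finite T"
    and b: "b > 1" "of_real b \<in> T" "of_real (1 / b) \<in> T"
    and circ: "\<And>t. t \<in> T \<Longrightarrow> t \<noteq> of_real b \<Longrightarrow> t \<noteq> of_real (1 / b) \<Longrightarrow> cmod t = 1"
    and conj: "\<And>q t. poly (map_poly of_rat q) (complex_of_real b) = 0 \<Longrightarrow> t \<in> T \<Longrightarrow> poly (map_poly of_rat q) t = 0"
  shows "salem_poly P"
proof -
  have Pt: "poly (of_int_poly P) t = 0 \<longleftrightarrow> t \<in> T" for t
    using T by (auto simp: P poly_prod)
  have "degree (of_int_poly P :: complex poly) = card T" "lead_coeff (of_int_poly P :: complex poly) = 1"
    unfolding P by (rule degree_prod_linear[OF T], rule lead_coeff_prod_linear)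
  then have deg: "degree P = card T" and lc: "lead_coeff P = 1" by auto
  have roots: "card T \<le> degree q \<and> (degree q \<le> card T \<longrightarrow> {t. poly (map_poly of_rat q) t = 0} = T)"
    if q: "q \<noteq> 0" "poly (map_poly of_rat q) (complex_of_real b) = 0" for q
  proof -
    let ?R = "{t :: complex. poly (map_poly of_rat q) t = 0}"
    have q0: "(map_poly of_rat q :: complex poly) \<noteq> 0" using q(1) by simp
    have fin: "finite ?R" by (rule poly_roots_finite[OF q0])
    have sub: "T \<subseteq> ?R" using conj q(2) by blast
    have "card ?R \<le> degree q" using card_poly_roots_bound[OF q0] by simp
    then show ?thesis using card_mono[OF fin sub] card_seteq[OF fin sub] by auto
  qed
  have min: "is_min_poly (of_int_poly P) (complex_of_real b)"
    unfolding is_min_poly_def using lc Pt b(2) roots deg by simp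
  have "galois_conjugates (complex_of_real b) = T"
  proof (intro equalityI subsetI)
    fix z assume "z \<in> T"
    then show "z \<in> galois_conjugates (complex_of_real b)"
      using min Pt by (auto simp: galois_conjugates_def intro!: exI[of _ "of_int_poly P"])
  next
    fix z assume "z \<in> galois_conjugates (complex_of_real b)"
    then obtain p where p: "is_min_poly p (complex_of_real b)" "poly (map_poly of_rat p) z = 0"
      by (auto simp: galois_conjugates_def)
    have "p \<noteq> 0" "poly (map_poly of_rat p) (complex_of_real b) = 0"
      using p(1) by (auto simp: is_min_poly_def)
    \<comment> \<open>Minimality of \<open>p\<close>, tested against \<open>P\<close>, leaves no
      room for roots outside \<open>T\<close>.\<close>
    moreover have "degree p \<le> card T"
    proof -
      have "P \<noteq> 0" using lc by auto
      then have "degree p \<le> degree (of_int_poly P :: rat poly)"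
        using p(1)[unfolded is_min_poly_def] Pt[of "of_real b"] b(2)
        by (metis of_int_poly_hom.hom_0_iff of_rat_of_int_poly)
      then show ?thesis using deg by simp
    qed
    ultimately show "z \<in> T" using roots[of p] p(2) by blast
  qed
  moreover have "T = {complex_of_real b, complex_of_real (1 / b)} \<union> {t \<in> T. cmod t = 1}"
    using b circ by auto
  moreover have "algebraic_int b"
  proof -
    have "algebraic_int (complex_of_real b)"
      unfolding algebraic_int_altdef_ipoly using lc Pt b(2) by blast
    then show ?thesis by simp
  qed
  ultimately have "salem_number b"
    unfolding salem_number_def using b(1) by (intro conjI exI[of _ "{t \<in> T. cmod t = 1}"]) auto
  then show ?thesis unfolding salem_poly_def is_int_min_poly_def using min by blast
qed


text \<open>Powers of the eigenvalues other than -1 stay conjugate to the corresponding power of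
  \<open>a\<close>, so it suffices to choose exponents that keep all eigenvalue powers distinct and
  fix the eigenvalue -1.\<close>

lemma coxeter_power_salem:
  assumes n: "n \<ge> 3"
  obtains N :: nat where "N > 0"
    "\<And>j. \<exists>P. salem_poly P \<and>
      char_poly (geom_rep n [0..<n] ^\<^sub>m Suc (N * j)) = P * (if odd n then [:1, 1:] else 1)"
    "inj (\<lambda>k. geom_rep n [0..<n] ^\<^sub>m k)"
proof -
  let ?A = "geom_rep n [0..<n]"
  obtain a :: real and S :: "complex set" where a1: "a > 1" and S: "finite S" "card S = n"
    and aS: "of_real a \<in> S" "of_real (1 / a) \<in> S"
    and circ: "\<And>s. s \<in> S \<Longrightarrow> s \<noteq> of_real a \<Longrightarrow> s \<noteq> of_real (1 / a) \<Longrightarrow> cmod s = 1"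
    and eq: "\<And>s. s \<in> S \<Longrightarrow> s \<noteq> 1 \<and> s * (s + 3) ^ n = (3 * s + 1) ^ n"
    and ev: "\<And>s. s \<in> S \<Longrightarrow> eigenvalue (map_mat of_int ?A) s"
    using coxeter_spectrum[OF n] by blast
  define c where "c = complex_of_real a"
  have S0: "0 \<notin> S" using eq[of 0] by auto
  have cp1: "of_int_poly (char_poly ?A) = (\<Prod>t\<in>S. [:- t, 1:])"
    by (rule char_poly_of_eigenvalues[OF geom_rep_carrier S ev])
  \<comment> \<open>At -1 the eigenvalue equation reads \<open>-(2 ^ n) = (-2) ^ n\<close>, which
    forces odd \<open>n\<close>; conversely \<open>w = -1\<close> gives the eigenvalue -1.\<close>
  have m1: "- 1 \<in> S \<longleftrightarrow> odd n"
  proof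
    assume "- 1 \<in> S"
    then have "- (2 ^ n) = (- 2 :: complex) ^ n" using eq[of "- 1"] by simp
    then show "odd n" by (cases "even n") auto
  next
    assume "odd n"
    then have "eigenvalue (map_mat of_int ?A) (- 1 :: complex)"
      using n by (intro coxeter_eigenvalue[of "- 1"]) auto
    then have "poly (char_poly (map_mat of_int ?A)) (- 1 :: complex) = 0"
      using eigenvalue_root_char_poly[of "map_mat of_int ?A" n "- 1 :: complex"] by auto
    then have "poly (\<Prod>t\<in>S. [:- t, 1:]) (- 1) = 0"
      unfolding of_int_hom.char_poly_hom[OF geom_rep_carrier] cp1 .
    then show "- 1 \<in> S" unfolding poly_prod_linear_eq_0_iff[OF S(1)] .
  qed
  define S' where "S' = S - {- 1}"
  \<comment> \<open>For odd \<open>k\<close> the eigenvalue -1 is its own k-th power, so for odd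
    \<open>n\<close> the factor \<open>x + 1\<close> splits off and the powers of \<open>S'\<close>
    remain.\<close>
  have factor: "\<exists>P. of_int_poly P = (\<Prod>t\<in>(\<lambda>s. s ^ k) ` S'. [:- t, 1:]) \<and>
      char_poly (?A ^\<^sub>m k) = P * (if odd n then [:1, 1:] else 1)"
    if inj: "inj_on (\<lambda>s. s ^ k) S" and k: "odd k" for k
  proof -
    let ?T = "(\<lambda>s. s ^ k) ` S"
    have ck: "?A ^\<^sub>m k \<in> carrier_mat n n" by simp
    have cp: "of_int_poly (char_poly (?A ^\<^sub>m k)) = (\<Prod>t\<in>?T. [:- t, 1:])"
    proof (rule char_poly_of_eigenvalues[OF ck])
      show "finite ?T" "card ?T = n" using S card_image[OF inj] by auto
      fix t assume "t \<in> ?T"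
      then obtain s where s: "s \<in> S" "t = s ^ k" by blast
      then obtain v where "eigenvector (map_mat of_int ?A) v s"
        using ev[OF s(1)] by (auto simp: eigenvalue_def)
      with s show "eigenvalue (map_mat of_int (?A ^\<^sub>m k)) t"
        unfolding eigenvalue_def of_int_hom.mat_hom_pow[OF geom_rep_carrier]
        using eigenvector_pow_mat[of "map_mat of_int ?A" n] by auto
    qed
    show ?thesis
    proof (cases "odd n")
      case False
      then have "S' = S" using m1 by (simp add: S'_def)
      then show ?thesis using cp False by (intro exI[of _ "char_poly (?A ^\<^sub>m k)"]) simp
    next
      case True
      then have mS: "- 1 \<in> S" using m1 by simp
      have T': "(\<lambda>s. s ^ k) ` S' = ?T - {- 1}"
        unfolding S'_def using inj_on_image_set_diff[OF inj, of S "{- 1}"] mS k by simp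
      have mT: "- 1 \<in> ?T" using mS k by (auto intro!: image_eqI[of _ _ "- 1"])
      have "poly (of_int_poly (char_poly (?A ^\<^sub>m k))) (- 1 :: complex) = 0"
        unfolding cp using mT S(1) poly_prod_linear_eq_0_iff[of ?T "- 1"] by blast
      then have "of_int (poly (char_poly (?A ^\<^sub>m k)) (- 1)) = (0 :: complex)"
        by (metis of_int_1 of_int_hom.poly_map_poly of_int_minus)
      then have "[:- (- 1), 1:] dvd char_poly (?A ^\<^sub>m k)"
        unfolding poly_eq_0_iff_dvd[symmetric] by simp
      then obtain P where P: "char_poly (?A ^\<^sub>m k) = [:1, 1:] * P" by (auto elim: dvdE)
      have "[:1, 1:] * of_int_poly P = (of_int_poly (char_poly (?A ^\<^sub>m k)) :: complex poly)"
        unfolding P of_int_poly_hom.hom_mult by simp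
      also have "\<dots> = [:1, 1:] * (\<Prod>t\<in>?T - {- 1}. [:- t, 1:])"
        unfolding cp using prod.remove[OF _ mT, of "\<lambda>t. [:- t, 1:]"] S(1) by simp
      finally have "of_int_poly P = (\<Prod>t\<in>?T - {- 1}. [:- t, 1:])"
        by (subst (asm) mult_cancel_left) simp
      then show ?thesis using P True T' by (intro exI[of _ P]) (simp add: mult.commute)
    qed
  qed
  have c: "cmod (1 / c) < 1" "cmod c > 1" using a1 by (simp_all add: c_def norm_divide)
  then have cne: "c \<noteq> - 1" "1 / c \<noteq> - 1" by (auto simp: norm_minus_cancel)
  have cS': "c \<in> S'" "1 / c \<in> S'" using aS cne by (simp_all add: S'_def c_def)
  have conj: "poly (map_poly of_rat q) s = 0" if "poly (map_poly of_rat q) c = 0" "s \<in> S'" for q s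
  proof -
    have "inj_on (\<lambda>s :: complex. s ^ 1) S" by simp
    then obtain P where "of_int_poly P = (\<Prod>t\<in>(\<lambda>s. s ^ 1) ` S'. [:- t, 1:])"
      using factor[of 1] by fastforce
    then have P: "of_int_poly P = (\<Prod>t\<in>S'. [:- t, 1:])" by simp
    show ?thesis
    proof (rule conjugates_of_int_poly_roots[OF P _ cS'(1) _ that])
      show "finite S'" using S by (simp add: S'_def)
      fix t assume t: "t \<in> S'" "t \<noteq> c"
      then have tS: "t \<in> S" "t \<noteq> - 1" "t \<noteq> 1" using eq by (auto simp: S'_def)
      have "cmod t \<le> 1" using t(2) tS(1) circ[of t] c(1) by (cases "t = 1 / c") (auto simp: c_def)
      moreover have "t \<noteq> 0" using tS S0 by auto
      \<comment> \<open>Only 1 and -1 could be roots of unity here; \<open>eq\<close> excludes the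
        first and \<open>S'\<close> the second.\<close>
      moreover have "t ^ m \<noteq> 1" if "m > 0" for m
        using root_of_unity_coxeter_equation[of t m n] that n eq[OF tS(1)] tS by auto
      ultimately show "cmod t \<le> 1 \<and> t \<noteq> 0 \<and> (\<forall>m>0. t ^ m \<noteq> 1)" by blast
    qed
  qed
  obtain N where N: "N > 0" "\<And>s t m. s \<in> S \<Longrightarrow> t \<in> S \<Longrightarrow> m > 0 \<Longrightarrow> s ^ m = t ^ m \<Longrightarrow> s ^ N = t ^ N"
    using finite_common_power_collisions[OF S(1)] by blast
  show ?thesis
  proof (rule that)
    show "2 * N > 0" using N(1) by simp
    show "inj (\<lambda>k. ?A ^\<^sub>m k)"
      by (rule inj_pow_mat_of_eigenvalue[OF geom_rep_carrier a1 ev[OF aS(1)]])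
    fix j
    \<comment> \<open>The factor 2 makes the exponent odd, and being 1 modulo \<open>N\<close> it
      causes no collisions.\<close>
    define k where "k = Suc (2 * N * j)"
    have k: "odd k" "k > 0" by (simp_all add: k_def)
    have "inj_on (\<lambda>s. s ^ k) S"
      using inj_on_power_if_collisions[where N = N and j = "2 * j", OF N(2) S0] by (simp only: k_def mult_ac)
    from factor[OF this k(1)] obtain P where P: "of_int_poly P = (\<Prod>t\<in>(\<lambda>s. s ^ k) ` S'. [:- t, 1:])"
      "char_poly (?A ^\<^sub>m k) = P * (if odd n then [:1, 1:] else 1)" by blast
    have "salem_poly P"
    proof (rule salem_poly_criterion[OF P(1)])
      show "finite ((\<lambda>s. s ^ k) ` S')" using S by (simp add: S'_def)
      show "1 < a ^ k" using a1 k by (simp add: one_less_power)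
      show "of_real (a ^ k) \<in> (\<lambda>s. s ^ k) ` S'" using cS'(1) by (auto simp: c_def)
      show "of_real (1 / a ^ k) \<in> (\<lambda>s. s ^ k) ` S'"
        using cS'(2) by (auto simp: c_def power_divide intro!: image_eqI[of _ _ "1 / c"])
    next
      fix t assume t: "t \<in> (\<lambda>s. s ^ k) ` S'" "t \<noteq> of_real (a ^ k)" "t \<noteq> of_real (1 / a ^ k)"
      then obtain s where s: "s \<in> S" "t = s ^ k" by (auto simp: S'_def)
      then have "s \<noteq> of_real a" "s \<noteq> of_real (1 / a)" using t by (auto simp: power_divide)
      then show "cmod t = 1" using circ[OF s(1)] by (simp add: s(2) norm_power)
    next
      fix q t assume q: "poly (map_poly of_rat q) (complex_of_real (a ^ k)) = 0" "t \<in> (\<lambda>s. s ^ k) ` S'"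
      then obtain s where s: "s \<in> S'" "t = s ^ k" by auto
      \<comment> \<open>Substituting \<open>x ^ k\<close> into \<open>q\<close> reduces conjugacy of
        the powers to that of the eigenvalues.\<close>
      have comp: "poly (map_poly of_rat (q \<circ>\<^sub>p monom 1 k)) x = poly (map_poly of_rat q) (x ^ k)"
        for x :: complex
        by (simp add: of_rat_hom.map_poly_pcompose poly_pcompose poly_monom)
      have "poly (map_poly of_rat (q \<circ>\<^sub>p monom 1 k)) c = 0" using q(1) by (simp add: comp c_def)
      then show "poly (map_poly of_rat q) t = 0" using conj[of "q \<circ>\<^sub>p monom 1 k" s] s(1) by (simp only: comp s(2))
    qed
    then show "\<exists>P. salem_poly P \<and>
      char_poly (?A ^\<^sub>m Suc (2 * N * j)) = P * (if odd n then [:1, 1:] else 1)"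
      using P(2) unfolding k_def by blast
  qed
qed

section \<open>The infinite family of powers and the conclusion\<close>

lemma geom_rep_pow_mem:
  assumes "w \<in> carrier (UC n)"
  shows "geom_rep n w ^\<^sub>m k \<in> geom_rep n ` carrier (UC n)"
proof (induction k)
  case 0
  have "geom_rep n w ^\<^sub>m 0 = geom_rep n []" by (simp add: geom_rep_def[of n "[]"])
  moreover have "[] \<in> carrier (UC n)" by (simp add: UC_def)
  ultimately show ?case by blast
next
  case (Suc k)
  then obtain u where u: "u \<in> carrier (UC n)" "geom_rep n w ^\<^sub>m k = geom_rep n u" by blast
  have "geom_rep n w ^\<^sub>m Suc k = geom_rep n (foldr uc_cons u w)"
    using u assms geom_rep_mult[of u n w] by (simp add: UC_def)
  moreover have "foldr uc_cons u w \<in> carrier (UC n)"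
    using u(1) assms foldr_uc_cons_closed[of w n u] by (simp add: UC_def)
  ultimately show ?case by blast
qed

theorem theorem3p2:
  fixes r :: nat
  assumes "r \<ge> 2"
  shows
    "(odd r \<longrightarrow>
        infinite {g \<in> geom_rep (r + 1) ` carrier (UC (r + 1)).
          generalized_salem_poly (char_poly g) \<and> degree (char_poly g) = r + 1})
     \<and> (even r \<longrightarrow>
        infinite {g \<in> geom_rep (r + 1) ` carrier (UC (r + 1)).
          \<exists>p. generalized_salem_poly p \<and> degree p = r \<and> char_poly g = p * [:1, 1:]})
     \<and> (odd r \<longrightarrow>
        salem_poly (char_poly (geom_rep (r + 1) (coxeter_element (r + 1)))) \<and>
        degree (char_poly (geom_rep (r + 1) (coxeter_element (r + 1)))) = r + 1)
     \<and> (even r \<longrightarrow>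
        (\<exists>p. salem_poly p \<and> degree p = r \<and>
          char_poly (geom_rep (r + 1) (coxeter_element (r + 1))) = p * [:1, 1:]))"
proof -
  let ?n = "r + 1"
  let ?A = "geom_rep ?n [0..<?n]"
  let ?I = "geom_rep ?n ` carrier (UC ?n)"
  have "?n \<ge> 3" using assms by simp
  then obtain N :: nat where N: "N > 0"
    and P: "\<And>j. \<exists>P. salem_poly P \<and>
      char_poly (?A ^\<^sub>m Suc (N * j)) = P * (if odd ?n then [:1, 1:] else 1)"
    and inj: "inj (\<lambda>k. ?A ^\<^sub>m k)"
    using coxeter_power_salem by blast
  have deg: "degree (char_poly (?A ^\<^sub>m k)) = ?n" for k
    using degree_monic_char_poly[of "?A ^\<^sub>m k" ?n] by simp
  have sg: "generalized_salem_poly p" if "salem_poly p" for p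
    using that by (auto simp: salem_poly_def generalized_salem_poly_def)
  \<comment> \<open>For \<open>j = 0\<close> the family contains the Coxeter element itself, so the
    same facts yield both claims.\<close>
  have A1: "?A ^\<^sub>m Suc (N * 0) = ?A" using left_mult_one_mat[OF geom_rep_carrier] by simp
  have "inj (\<lambda>j. ?A ^\<^sub>m Suc (N * j))"
  proof (rule injI)
    fix i j assume "?A ^\<^sub>m Suc (N * i) = ?A ^\<^sub>m Suc (N * j)"
    then have "Suc (N * i) = Suc (N * j)" by (rule injD[OF inj])
    then show "i = j" using N by simp
  qed
  then have inf: "infinite (range (\<lambda>j. ?A ^\<^sub>m Suc (N * j)))"
    using finite_imageD infinite_UNIV_nat by blast
  have "[0..<?n] \<in> carrier (UC ?n)"
    by (simp add: UC_def distinct_adj_conv_nth atLeast0LessThan nth_upt del: upt_Suc)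
  then have mem: "?A ^\<^sub>m k \<in> ?I" for k by (rule geom_rep_pow_mem)
  show ?thesis
  proof (cases "odd r")
    case True
    have salem: "salem_poly (char_poly (?A ^\<^sub>m Suc (N * j)))" for j using P[of j] True by auto
    have "range (\<lambda>j. ?A ^\<^sub>m Suc (N * j)) \<subseteq>
        {g \<in> ?I. generalized_salem_poly (char_poly g) \<and> degree (char_poly g) = ?n}"
      using mem sg salem deg by blast
    then have "infinite {g \<in> ?I. generalized_salem_poly (char_poly g) \<and> degree (char_poly g) = ?n}"
      using inf infinite_super by blast
    then show ?thesis
      using True salem[of 0] deg[of "Suc (N * 0)"] unfolding coxeter_element_eq A1 by blast
  next
    case False
    have salem: "\<exists>p. salem_poly p \<and> degree p = r \<and> char_poly (?A ^\<^sub>m Suc (N * j)) = p * [:1, 1:]" for j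
    proof -
      obtain p where p: "salem_poly p" "char_poly (?A ^\<^sub>m Suc (N * j)) = p * [:1, 1:]"
        using P[of j] False by auto
      then have "p \<noteq> 0" using deg[of "Suc (N * j)"] by (auto simp del: pow_mat.simps)
      then have "degree (p * [:1, 1:]) = degree p + 1" by (subst degree_mult_eq) auto
      then show ?thesis using p deg[of "Suc (N * j)"] by auto
    qed
    have "range (\<lambda>j. ?A ^\<^sub>m Suc (N * j)) \<subseteq>
        {g \<in> ?I. \<exists>p. generalized_salem_poly p \<and> degree p = r \<and> char_poly g = p * [:1, 1:]}"
      using mem sg salem by blast
    then have "infinite {g \<in> ?I. \<exists>p. generalized_salem_poly p \<and> degree p = r \<and> char_poly g = p * [:1, 1:]}"
      using inf infinite_super by blast
    then show ?thesis using False salem[of 0] unfolding coxeter_element_eq A1 by blast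
  qed
qed

end
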